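(* Assume the Generalized Lindelöf Hypothesis. For every $\epsilon > 0$ there is a constant $C_\epsilon > 0$ such that the following holds. Let $N \geq 3$ be real and let $\alpha$ be a real number such that $|\alpha - \frac{a}{q}| \leq \frac{1}{q N^{4/3}}$ for some integers $a$ and $q$ with $1 \leq q \leq N^{4/3}$ and $(a,q)=1$. Then there exist integers $a_1, a_2$ and prime numbers $q_1 < q_2 \leq N$ such that $$\Big|\alpha - \frac{a_1}{q_1} - \frac{a_2}{q_2}\Big| \leq \frac{C_\epsilon}{q N^{4/3 - \epsilon}}.$$
   Context: The Generalized Lindelöf Hypothesis is the assertion that for every Dirichlet character $\chi$ modulo $q$ and every $\epsilon>0$, $|L(\tfrac12 + it, \chi)| \ll_\epsilon (q(|t|+1))^{\epsilon}$ for all real $t$, with implied constant depending only on $\epsilon$, where $L(s,\chi)$ is the Dirichlet $L$-function. *)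

theory Defs
  imports "HOL-Complex_Analysis.Complex_Analysis" "HOL-Computational_Algebra.Primes"
begin

text \<open>Characters are functions on all integers, vanishing off the residues coprime to the
  modulus. The last clause forces \<open>chi 1 = 1\<close>.\<close>

definition dirichlet_character :: "nat \<Rightarrow> (int \<Rightarrow> complex) \<Rightarrow> bool" where
  "dirichlet_character q chi \<longleftrightarrow>
     q > 0 \<and>
     (\<forall>m n. chi (m * n) = chi m * chi n) \<and>
     (\<forall>n. chi (n + int q) = chi n) \<and>
     (\<forall>n. chi n \<noteq> 0 \<longleftrightarrow> coprime n (int q))"

definition principal_character :: "nat \<Rightarrow> int \<Rightarrow> complex" where
  "principal_character q n = (if coprime n (int q) then 1 else 0)"

definition dirichlet_series :: "(int \<Rightarrow> complex) \<Rightarrow> complex \<Rightarrow> complex" where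
  "dirichlet_series chi s = (\<Sum>n. chi (int (Suc n)) / of_nat (Suc n) powr s)"

text \<open>The \<open>L\<close>-function is the analytic continuation of the Dirichlet series from
  \<open>Re s > 1\<close>: its value at \<open>s\<close> is that of a continuation to some open right half-plane
  containing \<open>s\<close>, punctured at \<open>1\<close> if the character is principal. The punctured half-planes
  are nested and connected, so by the identity theorem the value depends neither on the
  half-plane nor on the continuation. At the pole (\<open>s = 1\<close>, principal character) the value
  is unspecified.\<close>

definition dirichlet_L :: "nat \<Rightarrow> (int \<Rightarrow> complex) \<Rightarrow> complex \<Rightarrow> complex" where
  "dirichlet_L q chi s =
     (THE z. \<exists>\<sigma> f. \<sigma> < Re s \<and>
        f holomorphic_on
          {w. Re w > \<sigma>} - (if chi = principal_character q then {1} else {}) \<and>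
        (\<forall>w. Re w > 1 \<longrightarrow> f w = dirichlet_series chi w) \<and>
        z = f s)"

definition generalized_lindelof_hypothesis :: bool where
  "generalized_lindelof_hypothesis \<longleftrightarrow>
     (\<forall>\<epsilon>::real. \<epsilon> > 0 \<longrightarrow> (\<exists>C::real. \<forall>q chi. dirichlet_character q chi \<longrightarrow>
        (\<forall>t::real. norm (dirichlet_L q chi (Complex (1/2) t)) \<le> C * (real q * (\<bar>t\<bar> + 1)) powr \<epsilon>)))"

end

theory Submission
  imports Defs "HOL-Number_Theory.Number_Theory" "HOL-Probability.Probability"
    "HOL-Real_Asymp.Real_Asymp"
begin

text \<open>For distinct primes \<open>p\<^sub>1, p\<^sub>2\<close> the sums \<open>a\<^sub>1/p\<^sub>1 + a\<^sub>2/p\<^sub>2\<close> are exactly the fractions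
  \<open>b/(p\<^sub>1 p\<^sub>2)\<close>, so it suffices to find primes close to \<open>N\<close> such that \<open>a p\<^sub>1 p\<^sub>2\<close> is congruent modulo
  \<open>q\<close> to some \<open>m\<close> with \<open>1 \<le> m \<le> N powr (2/3 + o(1))\<close>. These triples are counted with a smooth weight in
  \<open>m\<close> by the orthogonality of the characters modulo \<open>q\<close>. The principal character gives the main
  term, about \<open>N\<^sup>2 M powr (1/2) / q\<close> for \<open>m\<close> of size \<open>M\<close> weighted by \<open>m powr (-1/2)\<close>. For the other
  characters the sum over \<open>m\<close> is \<open>O(q powr o(1))\<close> by the Lindeloef hypothesis, and the mean value over
  the characters of the two prime sums is at most \<open>N (N/q + 1)\<close>; the main term wins as soon as
  \<open>M powr (1/2)\<close> exceeds \<open>(N + q) N powr o(1) / N\<close>, and \<open>q \<le> N powr (4/3)\<close>.\<close>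

text \<open>At the largest \<open>q\<close> the last condition reads M = N^(2/3 + o(1)), and then
  the error m / (q p1 p2) is, up to N^(o(1)), the distance 1 / (q N^(4/3)) that \<alpha> may have
  from a/q anyway. This balance is why 4/3 occurs both as the range of \<open>q\<close> and in the
  error. Existence needs only a positive weighted count, so no asymptotic formula enters. The supply
  of primes and the main term are both bounded below by Chebyshev's elementary estimate; the lost
  powers N^(o(1)) are absorbed by \<epsilon>. In the main term only prime m not dividing
  \<open>q\<close> are kept, which avoids sieving by the prime factors of \<open>q\<close>. The
  smooth weight does not vanish for large m, so its tail must be shown to be smaller than the main
  term before a small m can be extracted. The two primes come from disjoint sets of equal size:
  disjoint so that they differ, equal so that one mean value bound serves both. Every threshold for
  \<open>N\<close> is uniform in \<open>q\<close>, \<open>a\<close> and \<alpha>; the bounded range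
  of \<open>N\<close> below it is absorbed by the constant.\<close>

section \<open>Primes in short logarithmic ranges\<close>

text \<open>The numbers \<open>1 / (m * (n choose m))\<close> form the Leibniz harmonic triangle: its first column
  is \<open>1 / n\<close>, and every other entry is a difference of two entries of the preceding column.\<close>

lemma leibniz_triangle_Lcm:
  assumes "1 \<le> m" "m \<le> n"
  shows "real (Lcm {1..n}) / (real m * real (n choose m)) \<in> \<int>"
  using assms
proof (induction m arbitrary: n rule: nat_induct_at_least)
  case base
  have "n dvd Lcm {1..n}" using base by (intro dvd_Lcm) auto
  then obtain k where "Lcm {1..n} = n * k" by blast
  then show ?case using base by simp
next
  case (Suc m)
  then obtain n' where n': "n = Suc n'" "m \<le> n'" by (cases n) auto
  define D where "D = Lcm {1..n}"
  have 1: "real (Lcm {1..n'}) / (real m * real (n' choose m)) \<in> \<int>" using Suc n' by auto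
  have 2: "real D / (real m * real (n choose m)) \<in> \<int>" unfolding D_def using Suc by auto
  have "Lcm {1..n'} dvd D" unfolding D_def by (rule Lcm_subset) (use n' in auto)
  then obtain k where k: "D = Lcm {1..n'} * k" by blast
  have 3: "real D / (real m * real (n' choose m)) \<in> \<int>"
  proof -
    have "real k * (real (Lcm {1..n'}) / (real m * real (n' choose m))) \<in> \<int>"
      using 1 by (intro Ints_mult) auto
    then show ?thesis by (simp add: k mult_ac del: One_nat_def)
  qed
  define A where "A = real (n' choose m)"
  define B where "B = real (n choose m)"
  define E where "E = real (n choose Suc m)"
  have E: "real (Suc m) * E = real n * A"
    unfolding A_def E_def n' of_nat_mult[symmetric] by (simp only: Suc_times_binomial)
  have "(n - m) * (n choose m) = n * (n' choose m)"
    using binomial_absorb_comp[of n m] n' by simp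
  then have B: "(real n - real m) * B = real n * A"
    unfolding A_def B_def of_nat_mult[symmetric] using n' by (simp flip: of_nat_diff of_nat_mult del: of_nat_Suc)
  have pos: "A > 0" "B > 0" "E > 0" "real m > 0" "real n > 0"
    unfolding A_def B_def E_def using n' Suc by (auto simp: zero_less_binomial simp del: binomial_Suc_Suc)
  have "real D / (real (Suc m) * E) = real D / (real m * A) - real D / (real m * B)"
  proof -
    have "1 / B = (real n - real m) / (real n * A)"
      using B pos by (simp add: field_simps)
    then have "1 / A - 1 / B = 1 / A - (real n - real m) / (real n * A)" by simp
    also have "\<dots> = real m / (real n * A)" using pos by (simp add: divide_simps)
    finally have "1 / A - 1 / B = real m / (real n * A)" .
    then have "real D / real m * (1 / A - 1 / B) = real D / (real n * A)"
      using pos by simp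
    then show ?thesis unfolding E using pos by (simp add: algebra_simps)
  qed
  then show ?case
    using Ints_diff[OF 3 2] unfolding A_def B_def E_def D_def by simp
qed

text \<open>The exponent of a prime p in the least common multiple is at most the largest e with p^e
  \<le> n, so every prime contributes a factor of at most n.\<close>

lemma Lcm_atLeastAtMost_le:
  fixes n :: nat
  assumes "n > 0"
  shows "Lcm {1..n} \<le> n ^ card {p. prime p \<and> p \<le> n}"
proof -
  define P where "P = {p. prime p \<and> p \<le> n}"
  have fin: "finite P" unfolding P_def by auto
  define e where "e = (\<lambda>p. Max {i. p ^ i \<le> n})"
  have fin_e: "finite {i. p ^ i \<le> n}" if "p \<in> P" for p
  proof (rule finite_subset)
    show "{i. p ^ i \<le> n} \<subseteq> {..n}"
    proof safe
      fix i assume "p ^ i \<le> n"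
      moreover have "i < p ^ i" using that by (intro power_gt_expt) (auto simp: P_def intro: prime_gt_Suc_0_nat)
      ultimately show "i \<le> n" by linarith
    qed
  qed auto
  have e_le: "p ^ e p \<le> n" if "p \<in> P" for p
  proof -
    have "0 \<in> {i. p ^ i \<le> n}" using assms by simp
    then have "Max {i. p ^ i \<le> n} \<in> {i. p ^ i \<le> n}" using fin_e[OF that] Max_in by blast
    then show ?thesis unfolding e_def by simp
  qed
  have "Lcm {1..n} dvd (\<Prod>p\<in>P. p ^ e p)"
  proof (rule Lcm_least)
    fix k assume "k \<in> {1..n}"
    then have k: "k > 0" "k \<le> n" by auto
    have "k = (\<Prod>p\<in>prime_factors k. p ^ multiplicity p k)"
      using prime_factorization_nat k by simp
    also have "\<dots> dvd (\<Prod>p\<in>prime_factors k. p ^ e p)"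
    proof (rule prod_dvd_prod)
      fix p assume p: "p \<in> prime_factors k"
      then have "p \<in> P" unfolding P_def using k by (auto simp: prime_factors_dvd dest!: dvd_imp_le)
      have "p ^ multiplicity p k \<le> n"
        using dvd_imp_le[OF multiplicity_dvd[of p k]] k by linarith
      then have "multiplicity p k \<le> e p" unfolding e_def
        by (intro Max_ge fin_e \<open>p \<in> P\<close>) auto
      then show "p ^ multiplicity p k dvd p ^ e p" by (rule le_imp_power_dvd)
    qed
    also have "\<dots> dvd (\<Prod>p\<in>P. p ^ e p)"
    proof (rule prod_dvd_prod_subset[OF fin])
      show "prime_factors k \<subseteq> P" unfolding P_def using k by (auto simp: prime_factors_dvd dest!: dvd_imp_le)
    qed
    finally show "k dvd (\<Prod>p\<in>P. p ^ e p)" .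
  qed
  moreover have "(\<Prod>p\<in>P. p ^ e p) > 0" by (rule prod_pos) (auto simp: P_def prime_gt_0_nat)
  ultimately have "Lcm {1..n} \<le> (\<Prod>p\<in>P. p ^ e p)" by (rule dvd_imp_le)
  also have "\<dots> \<le> (\<Prod>p\<in>P. n)" by (rule prod_mono) (use e_le in auto)
  also have "\<dots> = n ^ card P" by simp
  finally show ?thesis unfolding P_def .
qed

text \<open>Nair's argument: by the Leibniz triangle m (2m choose m), which is at least 4^m / 2,
  divides the least common multiple of 1, ..., 2m. So that multiple is exponentially large although
  each prime contributes at most 2m, and there must be many primes.\<close>

lemma four_power_le_power_prime_count:
  assumes "m > 0"
  shows "4 ^ m \<le> 2 * real (2 * m) ^ card {p. prime p \<and> p \<le> 2 * m}"
proof -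
  define D where "D = real (Lcm {1..2*m}) / (real m * real ((2*m) choose m))"
  have "D \<in> \<int>" unfolding D_def using assms by (intro leibniz_triangle_Lcm) auto
  moreover have "Lcm {1..2*m} \<noteq> 0" by (subst Lcm_0_iff) auto
  then have "D > 0" using assms unfolding D_def
    by (intro divide_pos_pos mult_pos_pos) (auto simp: zero_less_binomial simp flip: neq0_conv simp del: One_nat_def Lcm_0_iff)
  ultimately have "D \<ge> 1" by (auto elim!: Ints_cases)
  have "4 ^ m / 2 \<le> real m * real ((2*m) choose m)"
    using central_binomial_lower_bound[OF assms] assms by (simp add: field_simps)
  also have "\<dots> \<le> real (Lcm {1..2*m})"
    using \<open>D \<ge> 1\<close> assms unfolding D_def by (simp add: field_simps zero_less_binomial del: One_nat_def)
  also have "\<dots> \<le> real ((2 * m) ^ card {p. prime p \<and> p \<le> 2 * m})"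
    using Lcm_atLeastAtMost_le[of "2*m"] assms by (subst of_nat_le_iff) auto
  finally show ?thesis by simp
qed

lemma card_primes_ge:
  fixes x :: real
  assumes "x \<ge> 4"
  shows "(x / 2 - 1) * ln 4 - ln 2 \<le> real (card {p::nat. prime p \<and> real p \<le> x}) * ln x"
proof -
  define m where "m = nat \<lfloor>x / 2\<rfloor>"
  have m: "real m \<le> x / 2" "x / 2 - 1 \<le> real m" "m > 0"
    unfolding m_def using assms by linarith+
  define S where "S = {p. prime p \<and> p \<le> 2 * m}"
  have "4 ^ m \<le> 2 * real (2 * m) ^ card S"
    unfolding S_def by (rule four_power_le_power_prime_count) fact
  then have "ln (4 ^ m) \<le> ln (2 * real (2 * m) ^ card S)"
    using m by (subst ln_le_cancel_iff) auto
  also have "\<dots> = ln 2 + real (card S) * ln (real (2 * m))"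
    using m by (subst ln_mult) (auto simp: ln_realpow simp del: of_nat_mult)
  also have "\<dots> \<le> ln 2 + real (card {p::nat. prime p \<and> real p \<le> x}) * ln x"
  proof (intro add_left_mono mult_mono)
    have "finite {p::nat. prime p \<and> real p \<le> x}"
      by (rule finite_subset[of _ "{..nat \<lfloor>x\<rfloor>}"]) (auto simp: le_nat_floor)
    then show "real (card S) \<le> real (card {p::nat. prime p \<and> real p \<le> x})"
      unfolding S_def using m by (intro of_nat_mono card_mono) auto
  qed (use m in auto)
  also have "ln (4 ^ m) = real m * ln 4" by (simp add: ln_realpow)
  finally have "real m * ln 4 - ln 2 \<le> real (card {p::nat. prime p \<and> real p \<le> x}) * ln x"
    by simp
  moreover have "(x / 2 - 1) * ln 4 \<le> real m * ln 4" using m by (intro mult_right_mono) auto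
  ultimately show ?thesis by linarith
qed

lemma card_prime_divisors_le:
  fixes q :: nat
  assumes "q > 0"
  shows "2 ^ card {p. prime p \<and> p dvd q} \<le> q"
proof -
  have "2 ^ card (prime_factors q) = (\<Prod>p\<in>prime_factors q. 2::nat)" by simp
  also have "\<dots> \<le> (\<Prod>p\<in>prime_factors q. p)"
    by (rule prod_mono) (auto intro: prime_ge_2_nat)
  also have "\<dots> \<le> (\<Prod>p\<in>prime_factors q. p ^ multiplicity p q)"
    by (intro prod_mono) (auto simp: prime_factors_multiplicity intro!: self_le_power intro: prime_ge_Suc_0_nat)
  also have "\<dots> = q" using prime_factorization_nat assms by simp
  finally show ?thesis using assms by (simp add: prime_factors_dvd)
qed

text \<open>The lower cutoff \<open>x / ln x ^ 2\<close> is low enough to be negligible against Chebyshev's lower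
  bound alone, and high enough for a Gaussian in \<open>ln (x / p)\<close> to cost only a factor \<open>x powr o(1)\<close>.\<close>

lemma eventually_many_primes:
  fixes \<delta> :: real
  assumes "\<delta> > 0"
  shows "eventually (\<lambda>x::real. \<forall>q::nat. q > 0 \<and> real q \<le> x ^ 2 \<longrightarrow>
    x powr (1 - \<delta>) \<le> real (card {p::nat. prime p \<and> x / ln x ^ 2 < real p \<and> real p \<le> x \<and> \<not> p dvd q})) at_top"
proof -
  \<comment> \<open>Chebyshev's bound for \<open>A\<close>, less the numbers below the cutoff (0 is
    counted, hence the 1), less the prime divisors of \<open>q\<close>, of which there are at most
    log_2 (x^2).\<close>
  have "eventually (\<lambda>x::real. x powr (1 - \<delta>) \<le> ((x / 2 - 1) * ln 4 - ln 2) / ln x - x / ln x ^ 2 - 1 - 2 * ln x / ln 2) at_top"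
    using assms by real_asymp
  moreover have "eventually (\<lambda>x::real. x \<ge> 4) at_top" by (rule eventually_ge_at_top)
  ultimately show ?thesis
  proof eventually_elim
    case (elim x)
    show ?case
    proof (intro allI impI)
      fix q :: nat assume q: "q > 0 \<and> real q \<le> x ^ 2"
      define A where "A = {p::nat. prime p \<and> real p \<le> x}"
      define B where "B = {p::nat. prime p \<and> p dvd q}"
      define C where "C = {p::nat. prime p \<and> x / ln x ^ 2 < real p \<and> real p \<le> x \<and> \<not> p dvd q}"
      define L where "L = {..nat \<lfloor>x / ln x ^ 2\<rfloor>}"
      have lnx: "ln x > 0" using elim by simp
      have fin: "finite {p::nat. real p \<le> x}"
        by (rule finite_subset[of _ "{..nat \<lfloor>x\<rfloor>}"]) (auto simp: le_nat_floor)
      have finB: "finite B" unfolding B_def using q by (intro finite_subset[OF _ finite_divisors_nat[of q]]) auto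
      have "A \<subseteq> C \<union> B \<union> L"
        unfolding A_def B_def C_def L_def by (auto simp: le_nat_floor not_less intro!: le_nat_floor)
      then have "card A \<le> card (C \<union> B \<union> L)"
        by (intro card_mono) (use finB fin in \<open>auto simp: C_def L_def\<close>)
      also have "\<dots> \<le> card C + card B + card L"
        using card_Un_le[of "C \<union> B" L] card_Un_le[of C B] by linarith
      finally have "real (card A) \<le> real (card C) + real (card B) + real (card L)" by simp
      moreover have "((x / 2 - 1) * ln 4 - ln 2) / ln x \<le> real (card A)"
        using card_primes_ge[of x] elim lnx unfolding A_def by (simp add: field_simps)
      moreover have "real (card L) \<le> x / ln x ^ 2 + 1"
        unfolding L_def using elim by simp
      moreover have "real (card B) \<le> 2 * ln x / ln 2"
      proof -
        have "2 ^ card B \<le> q" unfolding B_def using q by (intro card_prime_divisors_le) auto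
        then have "2 ^ card B \<le> x ^ 2" using q by (metis (mono_tags) of_nat_le_iff of_nat_numeral of_nat_power order_trans)
        then have "ln (2 ^ card B) \<le> ln (x ^ 2)" using elim by (subst ln_le_cancel_iff) auto
        then show ?thesis using elim by (simp add: ln_realpow field_simps)
      qed
      ultimately have "x powr (1 - \<delta>) \<le> real (card C)" using elim by linarith
      then show "x powr (1 - \<delta>) \<le> real (card {p::nat. prime p \<and> x / ln x ^ 2 < real p \<and> real p \<le> x \<and> \<not> p dvd q})"
        unfolding C_def .
    qed
  qed
qed

section \<open>Characters and orthogonality\<close>

lemma coprime_add_modulus: "coprime (n + m) m \<longleftrightarrow> coprime n m" for n m :: int
  by (metis cong_add_rcancel_0 cong_imp_coprime cong_sym cong_def mod_add_self2)

lemma cong_int_multE: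
  fixes a :: int
  assumes "coprime a (int q)"
  obtains b where "[a * b = 1] (mod int q)" "coprime b (int q)"
proof -
  obtain b where b: "[a * b = 1] (mod int q)" using cong_solve_coprime_int[OF assms] by blast
  have "coprime (a * b) (int q)" using cong_imp_coprime[OF cong_sym[OF b]] by simp
  then show ?thesis using b that by simp
qed

lemma exists_power_cong_1:
  assumes "coprime n (int q)" "q > 0"
  obtains k where "k > 0" "[n ^ k = 1] (mod int q)"
proof -
  define m where "m = nat (n mod int q)"
  have m: "int m = n mod int q" unfolding m_def using assms by simp
  have "coprime (int m) (int q)" unfolding m using assms by (metis cong_imp_coprime cong_mod_right cong_refl)
  then have "[m ^ totient q = 1] (mod q)" by (intro euler_theorem) simp
  then have "[int m ^ totient q = 1] (mod int q)" 
    using cong_int_iff[of "m ^ totient q" 1 q] by simp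
  moreover have "[n ^ totient q = int m ^ totient q] (mod int q)"
    by (rule cong_pow) (simp add: m)
  ultimately have "[n ^ totient q = 1] (mod int q)" by (rule cong_trans[rotated])
  then show ?thesis using that[of "totient q"] assms by simp
qed

text \<open>A character of a subgroup of the reduced residues modulo \<open>q\<close>, the subgroup being
  represented by the set \<open>H\<close> of all integers whose residue lies in it. Closure under inverses
  is automatic, since every reduced residue has finite order.\<close>

locale partial_character =
  fixes q :: nat and H :: "int set" and f :: "int \<Rightarrow> complex"
  assumes one_mem: "1 \<in> H"
    and coprime_mem: "n \<in> H \<Longrightarrow> coprime n (int q)"
    and cong_mem: "n \<in> H \<Longrightarrow> [n = m] (mod int q) \<Longrightarrow> m \<in> H"
    and cong_eq: "n \<in> H \<Longrightarrow> [n = m] (mod int q) \<Longrightarrow> f m = f n"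
    and mult_mem: "m \<in> H \<Longrightarrow> n \<in> H \<Longrightarrow> m * n \<in> H"
    and mult_eq: "m \<in> H \<Longrightarrow> n \<in> H \<Longrightarrow> f (m * n) = f m * f n"
    and nonzero: "n \<in> H \<Longrightarrow> f n \<noteq> 0"

lemma partial_character_power:
  assumes "partial_character q H f" "n \<in> H"
  shows "n ^ k \<in> H \<and> f (n ^ k) = f n ^ k"
proof (induction k)
  case 0
  have "f (1 * 1) = f 1 * f 1" "f 1 \<noteq> 0" "1 \<in> H" using assms(1) partial_character.mult_eq[OF assms(1), of 1 1]
    by (simp_all add: partial_character.one_mem partial_character.nonzero)
  then show ?case by (metis mult_cancel_right1 mult_1 power_0)
next
  case (Suc k)
  then show ?case using partial_character.mult_mem[OF assms] partial_character.mult_eq[OF assms] by simp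
qed

text \<open>If \<open>s ^ k\<close> is congruent to 1, then \<open>s ^ (k - 1)\<close> is an inverse
  of \<open>s\<close> that lies in \<open>H\<close>.\<close>

lemma partial_character_cancel:
  assumes pc: "partial_character q H f" and q: "q > 0" and "s \<in> H" "s * t \<in> H"
  shows "t \<in> H"
proof -
  have "coprime s (int q)" using partial_character.coprime_mem[OF pc \<open>s \<in> H\<close>] .
  then obtain k where k: "k > 0" "[s ^ k = 1] (mod int q)" using exists_power_cong_1 q by blast
  have "s ^ (k - 1) * (s * t) \<in> H"
    using partial_character_power[OF pc \<open>s \<in> H\<close>] \<open>s * t \<in> H\<close> partial_character.mult_mem[OF pc] by blast
  moreover have "s ^ (k - 1) * (s * t) = s ^ k * t" using k by (cases k) (auto simp: mult_ac)
  moreover have "[s ^ k * t = 1 * t] (mod int q)" by (intro cong_mult k cong_refl)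
  ultimately show ?thesis using partial_character.cong_mem[OF pc, of "s ^ k * t" t] by (metis mult_1)
qed

text \<open>One step of extension, to the group generated by \<open>H\<close> and \<open>x\<close>:
  put f'(s x^i) = f(s) z^i. Here \<open>k\<close> is the order of \<open>x\<close> modulo
  \<open>H\<close>, and every relation between \<open>x\<close> and \<open>H\<close> follows from
  x^k lying in \<open>H\<close>, so \<open>z\<close> may be any solution of z^k = f(x^k). Natural
  exponents suffice because \<open>x\<close> has finite order.\<close>

lemma partial_character_extend:
  assumes pc: "partial_character q H f" and q: "q > 0" and x: "coprime x (int q)"
    and k: "k > 0" "x ^ k \<in> H" "\<forall>j. 0 < j \<longrightarrow> j < k \<longrightarrow> x ^ j \<notin> H"
    and z: "z ^ k = f (x ^ k)"
  shows "\<exists>H' f'. partial_character q H' f' \<and> H \<subseteq> H' \<and> x \<in> H' \<and> (\<forall>n\<in>H. f' n = f n) \<and> f' x = z"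
proof -
  interpret partial_character q H f by (rule pc)
  note one = one_mem and cop = coprime_mem and cong = cong_mem cong_eq and mult = mult_mem mult_eq and nz = nonzero
  have f1: "f 1 = 1" using mult(2)[OF one one] nz[OF one] by (metis mult_1 mult_cancel_right1)
  have z0: "z \<noteq> 0" using nz[OF k(2)] z k(1) by (auto simp: power_0_left)
  \<comment> \<open>Dividing \<open>j\<close> by \<open>k\<close>, cancellation puts x^(j mod k)
    into \<open>H\<close>, and minimality of \<open>k\<close> forces the remainder to be 0.\<close>
  have dvd: "k dvd j \<and> f (x ^ j) = z ^ j" if "x ^ j \<in> H" for j
  proof -
    have "(x ^ k) ^ (j div k) \<in> H" and *: "f ((x ^ k) ^ (j div k)) = z ^ (k * (j div k))"
      using partial_character_power[OF pc k(2)] z by (auto simp: power_mult)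
    moreover have "(x ^ k) ^ (j div k) * x ^ (j mod k) = x ^ j"
      by (simp flip: power_mult power_add)
    ultimately have "x ^ (j mod k) \<in> H" using partial_character_cancel[OF pc q] that by metis
    then have "j mod k = 0" using k(3) k(1) by auto
    then have "k dvd j" by auto
    moreover then have "k * (j div k) = j" by simp
    ultimately show ?thesis using * by (simp flip: power_mult)
  qed
  \<comment> \<open>Two representations of one residue differ by the power x^(i - j), which then
    lies in \<open>H\<close>; there \<open>dvd\<close> makes the two candidate values agree.\<close>
  have wd_aux: "f s * z ^ i = f t * z ^ j"
    if "[s * x ^ i = t * x ^ j] (mod int q)" "s \<in> H" "t \<in> H" "j \<le> i" for s t i j
  proof -
    have "[s * x ^ (i - j) * x ^ j = t * x ^ j] (mod int q)"
      using that by (simp add: mult.assoc flip: power_add)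
    then have c: "[s * x ^ (i - j) = t] (mod int q)"
      using x by (subst (asm) cong_mult_rcancel) auto
    then have "s * x ^ (i - j) \<in> H" using cong that cong_sym by blast
    then have X: "x ^ (i - j) \<in> H" using partial_character_cancel[OF pc q] that by blast
    have "f s * z ^ (i - j) = f t"
      using dvd[OF X] mult[OF that(2) X] cong(2)[OF _ c] by auto
    then have "f t * z ^ j = f s * (z ^ (i - j) * z ^ j)" by simp
    then show ?thesis using that by (simp flip: power_add)
  qed
  have wd: "f s * z ^ i = f t * z ^ j"
    if "[s * x ^ i = t * x ^ j] (mod int q)" "s \<in> H" "t \<in> H" for s t i j
    using wd_aux[of s i t j] wd_aux[of t j s i] that cong_sym by (metis nat_le_linear)
  define H' where "H' = {n. \<exists>s\<in>H. \<exists>i. [n = s * x ^ i] (mod int q)}"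
  define f' where "f' = (\<lambda>n. SOME w. \<exists>s\<in>H. \<exists>i. [n = s * x ^ i] (mod int q) \<and> w = f s * z ^ i)"
  have f': "f' n = f s * z ^ i" if "[n = s * x ^ i] (mod int q)" "s \<in> H" for n s i
  proof -
    have "\<exists>w. \<exists>s\<in>H. \<exists>i. [n = s * x ^ i] (mod int q) \<and> w = f s * z ^ i" using that by blast
    then have "\<exists>s\<in>H. \<exists>i. [n = s * x ^ i] (mod int q) \<and> f' n = f s * z ^ i"
      unfolding f'_def by (rule someI_ex)
    then obtain t j where "t \<in> H" "[n = t * x ^ j] (mod int q)" "f' n = f t * z ^ j" by blast
    then show ?thesis using wd that by (metis cong_sym cong_trans)
  qed
  show ?thesis
  proof (intro exI conjI)
    show "H \<subseteq> H'"
    proof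
      fix n assume "n \<in> H" then show "n \<in> H'" unfolding H'_def
        by (intro CollectI bexI[of _ n] exI[of _ 0]) auto
    qed
    show "\<forall>n\<in>H. f' n = f n" using f'[of n n 0 for n] by simp
    show "f' x = z" using f'[of x 1 1] one f1 by simp
    show "x \<in> H'" unfolding H'_def by (intro CollectI bexI[of _ 1] exI[of _ 1]) (use one in auto)
    show "partial_character q H' f'"
    proof
      show "1 \<in> H'" using \<open>H \<subseteq> H'\<close> one by blast
    next
      fix n assume "n \<in> H'"
      then obtain s i where s: "s \<in> H" "[n = s * x ^ i] (mod int q)" unfolding H'_def by blast
      then show "coprime n (int q)" using cop[OF s(1)] x by (intro cong_imp_coprime[OF cong_sym[OF s(2)]]) auto
      show "f' n \<noteq> 0" using f'[OF s(2,1)] nz[OF s(1)] z0 by simp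
      fix m assume "[n = m] (mod int q)"
      then have m: "[m = s * x ^ i] (mod int q)" using s(2) cong_sym cong_trans by blast
      then show "m \<in> H'" using s unfolding H'_def by blast
      show "f' m = f' n" using f'[OF m s(1)] f'[OF s(2,1)] by simp
    next
      fix m n assume "m \<in> H'" "n \<in> H'"
      then obtain s i t j where s: "s \<in> H" "[m = s * x ^ i] (mod int q)"
        and t: "t \<in> H" "[n = t * x ^ j] (mod int q)" unfolding H'_def by blast
      have "[m * n = (s * x ^ i) * (t * x ^ j)] (mod int q)" by (intro cong_mult s t)
      then have c: "[m * n = (s * t) * x ^ (i + j)] (mod int q)" by (simp add: power_add mult_ac)
      have st: "s * t \<in> H" "f (s * t) = f s * f t" using mult s t by auto
      show "m * n \<in> H'" using c st unfolding H'_def by blast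
      show "f' (m * n) = f' m * f' n"
        using f'[OF c st(1)] f'[OF s(2,1)] f'[OF t(2,1)] st by (simp add: power_add)
    qed
  qed
qed

lemma exists_nontrivial_root_of_unity:
  assumes "d > (1::nat)"
  obtains z :: complex where "z ^ d = 1" "z \<noteq> 1"
proof -
  have "card {z::complex. z ^ d = 1} = d" using assms by (intro card_roots_unity_eq) auto
  then have "\<not> {z::complex. z ^ d = 1} \<subseteq> {1}"
    using assms card_mono[of "{1::complex}" "{z. z ^ d = 1}"] by auto
  then show ?thesis using that by blast
qed

lemma exists_least_power:
  assumes "coprime x (int q)" "q > 0" "1 \<in> H" "\<And>n m. n \<in> H \<Longrightarrow> [n = m] (mod int q) \<Longrightarrow> m \<in> H"
  obtains k where "k > 0" "x ^ k \<in> H" "\<forall>j. 0 < j \<longrightarrow> j < k \<longrightarrow> x ^ j \<notin> H"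
proof -
  obtain k where k: "k > 0" "[x ^ k = 1] (mod int q)" using exists_power_cong_1 assms by blast
  then have "k > 0 \<and> x ^ k \<in> H" using assms cong_sym by blast
  then have "(LEAST k. k > 0 \<and> x ^ k \<in> H) > 0 \<and> x ^ (LEAST k. k > 0 \<and> x ^ k \<in> H) \<in> H"
    by (rule LeastI)
  moreover have "x ^ j \<notin> H" if "0 < j" "j < (LEAST k. k > 0 \<and> x ^ k \<in> H)" for j
    using not_less_Least[OF that(2)] that(1) by blast
  ultimately show ?thesis using that by blast
qed

text \<open>Induction on the number of residues outside \<open>H\<close>: while a reduced residue
  \<open>x\<close> is missing, adjoining it lowers that number, and the complex root needed for its
  value always exists.\<close>

lemma partial_character_total:
  assumes "partial_character q H f" and q: "q > 0"
  shows "\<exists>H' f'. partial_character q H' f' \<and> H \<subseteq> H' \<and> {n. coprime n (int q)} \<subseteq> H' \<and> (\<forall>n\<in>H. f' n = f n)"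
  using assms(1)
proof (induction "card ({0..<int q} - H)" arbitrary: H f rule: less_induct)
  case less
  note pc = less.prems
  show ?case
  proof (cases "{n. coprime n (int q)} \<subseteq> H")
    case True
    then show ?thesis using pc by blast
  next
    case False
    then obtain x where x: "coprime x (int q)" "x \<notin> H" by blast
    have closed: "\<And>n m. n \<in> H \<Longrightarrow> [n = m] (mod int q) \<Longrightarrow> m \<in> H" "1 \<in> H"
      using partial_character.cong_mem[OF pc] partial_character.one_mem[OF pc] by blast+
    obtain k where k: "k > 0" "x ^ k \<in> H" "\<forall>j. 0 < j \<longrightarrow> j < k \<longrightarrow> x ^ j \<notin> H"
      by (rule exists_least_power[OF x(1) q closed(2)]) (use closed in auto)
    have "k \<noteq> 0" using k(1) by simp
    then obtain z where "f (x ^ k) = z ^ k" by (rule exists_complex_root)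
    then have z: "z ^ k = f (x ^ k)" by (rule sym)
    obtain H1 f1 where 1: "partial_character q H1 f1" "H \<subseteq> H1" "x \<in> H1" "\<forall>n\<in>H. f1 n = f n"
      using partial_character_extend[OF pc q x(1) k z] by (elim exE conjE) (rule that)
    have "x mod int q \<in> H1" using partial_character.cong_mem[OF 1(1,3)] by simp
    moreover have "x mod int q \<notin> H" using closed(1)[of "x mod int q" x] x(2) by auto
    moreover have "x mod int q \<in> {0..<int q}" using q by auto
    ultimately have "{0..<int q} - H1 \<subset> {0..<int q} - H" using 1(2) by blast
    then have "card ({0..<int q} - H1) < card ({0..<int q} - H)" by (intro psubset_card_mono) auto
    from less.hyps[OF this 1(1)] obtain H' f' where "partial_character q H' f'" "H1 \<subseteq> H'"
      "{n. coprime n (int q)} \<subseteq> H'" "\<forall>n\<in>H1. f' n = f1 n"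
      by (elim exE conjE) (rule that)
    moreover have "\<forall>n\<in>H. f' n = f n" using 1(2,4) calculation(4) by (metis subsetD)
    ultimately show ?thesis using 1(2) by (meson subset_trans)
  qed
qed

text \<open>Start from the trivial character on the class of 1. The order \<open>d\<close> of
  \<open>n\<close> exceeds 1, so \<open>n\<close> can be sent to a nontrivial \<open>d\<close>-th
  root of unity, and this value survives the extension to all reduced residues.\<close>

lemma exists_character_neq_1:
  assumes q: "q > 0" and n: "coprime n (int q)" and n1: "\<not> [n = 1] (mod int q)"
  obtains chi where "dirichlet_character q chi" "chi n \<noteq> 1"
proof -
  define H where "H = {m. [m = 1] (mod int q)}"
  have pc: "partial_character q H (\<lambda>_. 1)"
  proof
    show "1 \<in> H" unfolding H_def by simp
  next
    fix m assume m: "m \<in> H"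
    then show "coprime m (int q)" using cong_imp_coprime[of 1 m "int q"] cong_sym unfolding H_def by auto
    fix k
    show "k \<in> H" if "[m = k] (mod int q)" using m that cong_sym cong_trans unfolding H_def by blast
    show "m * k \<in> H" if "k \<in> H"
      using cong_mult[of m 1 "int q" k 1] m that unfolding H_def by simp
  qed simp_all
  obtain d where d: "d > 0" "n ^ d \<in> H" "\<forall>j. 0 < j \<longrightarrow> j < d \<longrightarrow> n ^ j \<notin> H"
  proof (rule exists_least_power[of n q H])
    fix k m assume "k \<in> H" "[k = m] (mod int q)"
    then show "m \<in> H" unfolding H_def using cong_sym cong_trans by blast
  qed (use n q in \<open>auto simp: H_def\<close>)
  have "d \<noteq> 1" using d(2) n1 unfolding H_def by auto
  then have "d > 1" using d(1) by simp
  then obtain z :: complex where z: "z ^ d = 1" "z \<noteq> 1" by (rule exists_nontrivial_root_of_unity)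
  obtain H1 f1 where 1: "partial_character q H1 f1" "n \<in> H1" "f1 n = z"
    using partial_character_extend[OF pc q n d, of z] z by auto
  obtain H2 f where 2: "partial_character q H2 f" "{n. coprime n (int q)} \<subseteq> H2" "f n = z"
    using partial_character_total[OF 1(1) q] 1(2,3) by auto
  define chi where "chi = (\<lambda>m. if coprime m (int q) then f m else 0)"
  have "dirichlet_character q chi"
    unfolding dirichlet_character_def
  proof (intro conjI allI q)
    fix m
    note c = coprime_add_modulus[of m "int q"]
    show "chi (m + int q) = chi m"
    proof (cases "coprime m (int q)")
      case True
      then have "m \<in> H2" using 2 by blast
      moreover have "[m = m + int q] (mod int q)" by (simp add: cong_def)
      ultimately have "f (m + int q) = f m" using partial_character.cong_eq[OF 2(1)] by blast
      then show ?thesis using c unfolding chi_def by simp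
    qed (use c in \<open>simp add: chi_def\<close>)
    show "chi m \<noteq> 0 \<longleftrightarrow> coprime m (int q)"
      using 2(2) partial_character.nonzero[OF 2(1)] unfolding chi_def by auto
    fix m' show "chi (m * m') = chi m * chi m'"
      using 2(2) partial_character.mult_eq[OF 2(1)] unfolding chi_def by auto
  qed
  then show ?thesis using that 2(3) z n unfolding chi_def by auto
qed

lemma dirichlet_character_cong:
  assumes "dirichlet_character q chi" "[m = n] (mod int q)"
  shows "chi m = chi n"
proof -
  have per: "chi (n + int q) = chi n" for n using assms(1) unfolding dirichlet_character_def by blast
  have pern: "chi (n + int k * int q) = chi n" for n k
  proof (induction k)
    case (Suc k)
    then show ?case using per[of "n + int k * int q"] by (simp add: algebra_simps)
  qed simp
  obtain k where k: "n = m + int q * k" using assms(2) unfolding cong_iff_lin by blast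
  show ?thesis
  proof (cases "k \<ge> 0")
    case True
    then show ?thesis using pern[of m "nat k"] k by (simp add: mult.commute)
  next
    case False
    then show ?thesis using pern[of n "nat (-k)"] k by (simp add: mult.commute)
  qed
qed

lemma dirichlet_character_mult:
  "dirichlet_character q chi \<Longrightarrow> chi (m * n) = chi m * chi n"
  unfolding dirichlet_character_def by blast

lemma dirichlet_character_eq_0_iff:
  "dirichlet_character q chi \<Longrightarrow> chi n = 0 \<longleftrightarrow> \<not> coprime n (int q)"
  unfolding dirichlet_character_def by blast

lemma dirichlet_character_1:
  assumes "dirichlet_character q chi"
  shows "chi 1 = 1"
proof -
  have "chi 1 \<noteq> 0" using dirichlet_character_eq_0_iff[OF assms] by simp
  moreover have "chi (1 * 1) = chi 1 * chi 1" by (rule dirichlet_character_mult[OF assms])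
  ultimately show ?thesis by (metis mult_1 mult_cancel_right1)
qed

lemma dirichlet_character_power:
  "dirichlet_character q chi \<Longrightarrow> chi (n ^ k) = chi n ^ k"
  by (induction k) (auto simp: dirichlet_character_1 dirichlet_character_mult)

lemma norm_dirichlet_character:
  assumes "dirichlet_character q chi"
  shows "norm (chi n) = (if coprime n (int q) then 1 else 0)"
proof (cases "coprime n (int q)")
  case True
  have "q > 0" using assms unfolding dirichlet_character_def by blast
  then obtain k where k: "k > 0" "[n ^ k = 1] (mod int q)" using exists_power_cong_1 True by blast
  have "chi n ^ k = 1"
    using dirichlet_character_cong[OF assms k(2)] dirichlet_character_power[OF assms]
      dirichlet_character_1[OF assms] by simp
  then have "norm (chi n) ^ k = 1 ^ k" by (metis norm_power norm_one power_one)
  then have "norm (chi n) = 1" using k(1) by (subst (asm) power_eq_iff_eq_base) auto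
  then show ?thesis using True by simp
qed (use dirichlet_character_eq_0_iff[OF assms] in auto)

section \<open>Finiteness and orthogonality of the characters\<close>

lemma principal_dirichlet_character:
  "q > 0 \<Longrightarrow> dirichlet_character q (principal_character q)"
  unfolding dirichlet_character_def principal_character_def
  by (auto simp: coprime_add_modulus)

lemma dirichlet_character_prod:
  assumes "dirichlet_character q chi" "dirichlet_character q psi"
  shows "dirichlet_character q (\<lambda>n. chi n * psi n)"
  using assms unfolding dirichlet_character_def by auto

text \<open>The values are 0 or roots of unity whose order divides \<open>totient q\<close>, and one
  period determines the character.\<close>

lemma finite_dirichlet_characters: "finite {chi. dirichlet_character q chi}"
proof (cases "q > 0")
  case True
  define K where "K = totient q"
  have K: "K > 0" unfolding K_def using True by simp
  define V where "V = insert 0 {z::complex. z ^ K = 1}"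
  have V: "chi n \<in> V" if "dirichlet_character q chi" for chi n
  proof (cases "coprime n (int q)")
    case c: True
    define m where "m = nat (n mod int q)"
    have m: "int m = n mod int q" unfolding m_def using True by simp
    have "coprime (int m) (int q)" unfolding m using c by (metis cong_imp_coprime cong_mod_right cong_refl)
    then have "[m ^ K = 1] (mod q)" unfolding K_def by (intro euler_theorem) simp
    then have "[int m ^ K = 1] (mod int q)" using cong_int_iff[of "m ^ K" 1 q] by simp
    moreover have "[n ^ K = int m ^ K] (mod int q)" by (rule cong_pow) (simp add: m)
    ultimately have "[n ^ K = 1] (mod int q)" by (rule cong_trans[rotated])
    then show ?thesis
      using dirichlet_character_cong[OF that] dirichlet_character_power[OF that]
        dirichlet_character_1[OF that] unfolding V_def by fastforce
  qed (use dirichlet_character_eq_0_iff[OF that] in \<open>auto simp: V_def\<close>)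
  have "finite ({0..<int q} \<rightarrow>\<^sub>E V)"
    unfolding V_def using K by (intro finite_PiE) (auto intro: finite_roots_unity)
  moreover have "(\<lambda>chi. restrict chi {0..<int q}) ` {chi. dirichlet_character q chi} \<subseteq> {0..<int q} \<rightarrow>\<^sub>E V"
    using V by auto
  moreover have "inj_on (\<lambda>chi. restrict chi {0..<int q}) {chi. dirichlet_character q chi}"
  proof (intro inj_onI ext)
    fix chi psi n assume *: "chi \<in> {chi. dirichlet_character q chi}" "psi \<in> {chi. dirichlet_character q chi}"
      "restrict chi {0..<int q} = restrict psi {0..<int q}"
    have "chi (n mod int q) = psi (n mod int q)"
      using fun_cong[OF *(3), of "n mod int q"] True by simp
    moreover have "[n mod int q = n] (mod int q)" by simp
    ultimately show "chi n = psi n" using * dirichlet_character_cong by (metis mem_Collect_eq)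
  qed
  ultimately show ?thesis by (meson finite_imageD finite_subset)
qed (auto simp: dirichlet_character_def)

text \<open>Multiplication by a character \<open>psi\<close> with psi(n) \<noteq> 1 permutes the
  characters, so the sum equals psi(n) times itself and vanishes.\<close>

lemma sum_dirichlet_characters:
  assumes q: "q > 0" and n: "coprime n (int q)"
  shows "(\<Sum>chi | dirichlet_character q chi. chi n) =
    (if [n = 1] (mod int q) then of_nat (card {chi. dirichlet_character q chi}) else 0)"
proof (cases "[n = 1] (mod int q)")
  case True
  then have "(\<Sum>chi | dirichlet_character q chi. chi n) = (\<Sum>chi | dirichlet_character q chi. 1)"
    by (intro sum.cong) (auto simp: dirichlet_character_cong[OF _ True] dirichlet_character_1 simp del: One_nat_def)
  then show ?thesis using True by simp
next
  case False
  then obtain psi where psi: "dirichlet_character q psi" "psi n \<noteq> 1" using exists_character_neq_1 assms by blast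
  define X where "X = {chi. dirichlet_character q chi}"
  have "inj_on (\<lambda>chi m. psi m * chi m) X"
  proof (intro inj_onI ext)
    fix chi chi' m assume *: "chi \<in> X" "chi' \<in> X" "(\<lambda>m. psi m * chi m) = (\<lambda>m. psi m * chi' m)"
    \<comment> \<open>Either \<open>psi m\<close> can be cancelled, or \<open>m\<close> is not
      coprime to \<open>q\<close> and both sides are 0.\<close>
    show "chi m = chi' m"
      using fun_cong[OF *(3), of m] *(1,2) psi(1) dirichlet_character_eq_0_iff[of q psi m]
        dirichlet_character_eq_0_iff[of q chi m] dirichlet_character_eq_0_iff[of q chi' m]
      unfolding X_def by auto
  qed
  moreover have "(\<lambda>chi m. psi m * chi m) ` X \<subseteq> X"
    using dirichlet_character_prod psi unfolding X_def by auto
  ultimately have "bij_betw (\<lambda>chi m. psi m * chi m) X X"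
    using finite_dirichlet_characters endo_inj_surj unfolding X_def bij_betw_def by blast
  from sum.reindex_bij_betw[OF this, of "\<lambda>chi. chi n"]
  have "(\<Sum>chi\<in>X. psi n * chi n) = (\<Sum>chi\<in>X. chi n)" .
  then have "psi n * (\<Sum>chi\<in>X. chi n) = (\<Sum>chi\<in>X. chi n)" by (simp add: sum_distrib_left)
  then have "(\<Sum>chi\<in>X. chi n) = 0" using psi(2) by simp
  then show ?thesis using False unfolding X_def by simp
qed

text \<open>The conjugate of chi(m) is chi(m') for an inverse m' of m modulo \<open>q\<close>, which
  reduces the claim to the sum of chi(m' n).\<close>

lemma sum_cnj_dirichlet_characters:
  assumes q: "q > 0" and "coprime m (int q)"
  shows "(\<Sum>chi | dirichlet_character q chi. cnj (chi m) * chi n) =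
    (if [m = n] (mod int q) then of_nat (card {chi. dirichlet_character q chi}) else 0)"
proof (cases "coprime n (int q)")
  case True
  obtain m' where m': "[m * m' = 1] (mod int q)" "coprime m' (int q)" using cong_int_multE assms by blast
  have "cnj (chi m) * chi n = chi (m' * n)" if "dirichlet_character q chi" for chi
  proof -
    have 1: "chi m * chi m' = 1"
      using dirichlet_character_cong[OF that m'(1)] dirichlet_character_1[OF that]
        dirichlet_character_mult[OF that] by simp
    have 2: "chi m * cnj (chi m) = 1"
      using norm_dirichlet_character[OF that, of m] assms by (simp add: complex_norm_square[symmetric])
    have "cnj (chi m) = cnj (chi m) * (chi m * chi m')" using 1 by simp
    also have "\<dots> = chi m'" using 2 by (simp add: mult.assoc[symmetric] mult.commute)
    finally show ?thesis using dirichlet_character_mult[OF that] by simp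
  qed
  then have "(\<Sum>chi | dirichlet_character q chi. cnj (chi m) * chi n) = (\<Sum>chi | dirichlet_character q chi. chi (m' * n))"
    by (intro sum.cong) auto
  also have "\<dots> = (if [m' * n = 1] (mod int q) then of_nat (card {chi. dirichlet_character q chi}) else 0)"
    using True m' q by (intro sum_dirichlet_characters) auto
  also have "[m' * n = 1] (mod int q) \<longleftrightarrow> [m = n] (mod int q)"
  proof -
    have "[m' * n = 1] (mod int q) \<longleftrightarrow> [m' * n = m' * m] (mod int q)"
      using m'(1) by (metis cong_sym cong_trans mult.commute)
    also have "\<dots> \<longleftrightarrow> [n = m] (mod int q)" using m'(2) by (rule cong_mult_lcancel)
    finally show ?thesis by (auto intro: cong_sym)
  qed
  finally show ?thesis .
next
  case False
  then have "\<not> [m = n] (mod int q)" using assms(2) cong_imp_coprime by blast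
  moreover have "(\<Sum>chi | dirichlet_character q chi. cnj (chi m) * chi n) = 0"
    using False by (intro sum.neutral) (auto simp: dirichlet_character_eq_0_iff)
  ultimately show ?thesis by simp
qed

lemma sum_nonprincipal_character_period:
  assumes chi: "dirichlet_character q chi" "chi \<noteq> principal_character q"
  shows "(\<Sum>r\<in>{0..<int q}. chi r) = 0"
proof -
  have q: "q > 0" using chi unfolding dirichlet_character_def by blast
  have "\<exists>n. coprime n (int q) \<and> chi n \<noteq> 1"
    using chi dirichlet_character_eq_0_iff[OF chi(1)] unfolding principal_character_def fun_eq_iff by fastforce
  then obtain n where n: "coprime n (int q)" "chi n \<noteq> 1" by blast
  define f where "f = (\<lambda>r. (n * r) mod int q)"
  have "inj_on f {0..<int q}"
  proof (rule inj_onI)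
    fix x y assume xy: "x \<in> {0..<int q}" "y \<in> {0..<int q}" "f x = f y"
    then have "[n * x = n * y] (mod int q)" unfolding f_def cong_def by simp
    then have "[x = y] (mod int q)" using n by (simp add: cong_mult_lcancel)
    then show "x = y" using xy by (simp add: cong_def)
  qed
  moreover have "f ` {0..<int q} \<subseteq> {0..<int q}" unfolding f_def using q by auto
  ultimately have "bij_betw f {0..<int q} {0..<int q}"
    unfolding bij_betw_def using endo_inj_surj[of "{0..<int q}" f] by auto
  from sum.reindex_bij_betw[OF this, of chi]
  have "(\<Sum>r\<in>{0..<int q}. chi (f r)) = (\<Sum>r\<in>{0..<int q}. chi r)" .
  moreover have "chi (f r) = chi n * chi r" for r
    using dirichlet_character_cong[OF chi(1), of "f r" "n * r"] dirichlet_character_mult[OF chi(1)]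
    unfolding f_def by simp
  ultimately have "chi n * (\<Sum>r\<in>{0..<int q}. chi r) = (\<Sum>r\<in>{0..<int q}. chi r)"
    by (simp add: sum_distrib_left)
  then show ?thesis using n(2) by simp
qed

text \<open>Double counting of chi(r) over all characters and one period. Summed over
  \<open>r\<close> first, only the principal character survives and leaves \<open>q\<close> terms of
  norm at most 1; summed over the characters first, only the class of 1 survives and leaves the
  number of characters.\<close>

lemma card_dirichlet_characters_le:
  assumes q: "q > 0"
  shows "card {chi. dirichlet_character q chi} \<le> q"
proof -
  define X where "X = {chi. dirichlet_character q chi}"
  have fin: "finite X" unfolding X_def by (rule finite_dirichlet_characters)
  have P: "principal_character q \<in> X" unfolding X_def using principal_dirichlet_character q by blast
  define S where "S = (\<Sum>r\<in>{0..<int q}. principal_character q r)"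
  have "(\<Sum>chi\<in>X. \<Sum>r\<in>{0..<int q}. chi r) = S + (\<Sum>chi\<in>X - {principal_character q}. \<Sum>r\<in>{0..<int q}. chi r)"
    unfolding S_def using fin P by (rule sum.remove)
  also have "(\<Sum>chi\<in>X - {principal_character q}. \<Sum>r\<in>{0..<int q}. chi r) = 0"
    by (intro sum.neutral ballI sum_nonprincipal_character_period) (auto simp: X_def)
  finally have 1: "(\<Sum>chi\<in>X. \<Sum>r\<in>{0..<int q}. chi r) = S" by simp
  have "(\<Sum>chi\<in>X. \<Sum>r\<in>{0..<int q}. chi r) = (\<Sum>r\<in>{0..<int q}. \<Sum>chi\<in>X. chi r)" by (rule sum.swap)
  \<comment> \<open>The form \<open>1 mod int q\<close> matters for \<open>q = 1\<close>, where the
    class of 1 is represented by 0.\<close>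
  also have "\<dots> = (\<Sum>r\<in>{0..<int q}. if r = 1 mod int q then of_nat (card X) else 0)"
  proof (intro sum.cong refl)
    fix r assume r: "r \<in> {0..<int q}"
    have "(\<Sum>chi\<in>X. cnj (chi 1) * chi r) = (if [1 = r] (mod int q) then of_nat (card X) else 0)"
      unfolding X_def using q by (intro sum_cnj_dirichlet_characters) auto
    moreover have "(\<Sum>chi\<in>X. cnj (chi 1) * chi r) = (\<Sum>chi\<in>X. chi r)"
      by (intro sum.cong) (auto simp: X_def dirichlet_character_1)
    moreover have "[1 = r] (mod int q) \<longleftrightarrow> r = 1 mod int q" using r by (auto simp: cong_def)
    ultimately show "(\<Sum>chi\<in>X. chi r) = (if r = 1 mod int q then of_nat (card X) else 0)" by simp
  qed
  also have "\<dots> = of_nat (card X)" using q by (subst sum.delta) auto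
  finally have "of_nat (card X) = S" using 1 by simp
  then have "real (card X) = norm S" by (metis norm_of_nat)
  also have "\<dots> \<le> (\<Sum>r\<in>{0..<int q}. 1)" unfolding S_def
    by (rule sum_norm_le) (auto simp: principal_character_def)
  finally show ?thesis unfolding X_def by simp
qed

section \<open>Continuation of the L-function and smoothed character sums\<close>

lemma norm_powr_diff_le:
  fixes x y :: real and s :: complex
  assumes "0 < y" "y \<le> x" "Re s > 0"
  shows "norm (of_real x powr (-s) - of_real y powr (-s)) \<le> norm s * y powr (-Re s - 1) * (x - y)"
proof -
  define S where "S = closed_segment (complex_of_real y) (of_real x)"
  have S: "\<exists>t. z = of_real t \<and> y \<le> t" if "z \<in> S" for z
    using that assms unfolding S_def closed_segment_of_real by (auto simp: closed_segment_eq_real_ivl)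
  have "norm (of_real x powr (-s) - of_real y powr (-s))
      \<le> (norm s * y powr (-Re s - 1)) * norm (complex_of_real x - of_real y)"
  proof (rule field_differentiable_bound[of S])
    show "convex S" unfolding S_def by (rule convex_closed_segment)
    fix z assume "z \<in> S"
    then obtain t where t: "z = of_real t" "y \<le> t" using S by blast
    then have "z \<notin> \<real>\<^sub>\<le>\<^sub>0" using assms by (auto simp: complex_nonpos_Reals_iff)
    then show "((\<lambda>z. z powr (-s)) has_field_derivative (-s * z powr (-s - 1))) (at z within S)"
      by (rule has_field_derivative_at_within[OF has_field_derivative_powr])
    have "norm (-s * z powr (-s - 1)) = norm s * t powr (-Re s - 1)"
      using t assms by (simp add: norm_mult norm_powr_real_powr)
    also have "\<dots> \<le> norm s * y powr (-Re s - 1)"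
      using t assms by (intro mult_left_mono powr_mono2') auto
    finally show "norm (-s * z powr (-s - 1)) \<le> norm s * y powr (-Re s - 1)" .
  qed (auto simp: S_def)
  also have "norm (complex_of_real x - of_real y) = x - y"
    using assms by (simp flip: of_real_diff)
  finally show ?thesis .
qed

lemma summable_Suc_powr:
  assumes "c > 0"
  shows "summable (\<lambda>k. real (Suc k) powr (-c - 1))"
  using assms summable_real_powr_iff[of "-c - 1"] by (subst summable_Suc_iff) auto

definition dirichlet_term :: "(int \<Rightarrow> complex) \<Rightarrow> complex \<Rightarrow> nat \<Rightarrow> complex" where
  "dirichlet_term chi s n = chi (int (Suc n)) / of_nat (Suc n) powr s"

locale nonprincipal_character =
  fixes q :: nat and chi :: "int \<Rightarrow> complex"
  assumes char: "dirichlet_character q chi" and nonprincipal: "chi \<noteq> principal_character q"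
begin

lemma q_pos: "q > 0"
  using char unfolding dirichlet_character_def by blast

text \<open>Grouped into full periods, over which the character sums to \<open>0\<close>, the Dirichlet series
  converges absolutely for \<open>Re s > 0\<close>.\<close>

definition block :: "nat \<Rightarrow> complex \<Rightarrow> complex" where
  "block k s = (\<Sum>i\<in>{k*q..<k*q+q}. dirichlet_term chi s i)"

lemma sum_block: "(\<Sum>k<K. block k s) = (\<Sum>n<K*q. dirichlet_term chi s n)"
  unfolding block_def by (rule sum.nat_group)

lemma sum_char_block: "(\<Sum>i\<in>{k*q..<k*q+q}. chi (int (Suc i))) = 0"
proof -
  define f where "f = (\<lambda>i. (int i + 1) mod int q)"
  have inj: "inj_on f {k*q..<k*q+q}"
  proof (rule inj_onI)
    fix x y assume xy: "x \<in> {k*q..<k*q+q}" "y \<in> {k*q..<k*q+q}" "f x = f y"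
    then have "[int x + 1 = int y + 1] (mod int q)" unfolding f_def cong_def by simp
    then have "[int x = int y] (mod int q)" by (simp add: cong_add_rcancel)
    then have "int q dvd int x - int y" by (simp add: cong_iff_dvd_diff)
    then have "\<bar>int q\<bar> \<le> \<bar>int x - int y\<bar>" if "int x - int y \<noteq> 0" using dvd_imp_le_int that by blast
    moreover have "\<bar>int x - int y\<bar> < int q" using xy by auto
    ultimately show "x = y" by auto
  qed
  have "f ` {k*q..<k*q+q} = {0..<int q}"
  proof (rule card_subset_eq)
    show "f ` {k*q..<k*q+q} \<subseteq> {0..<int q}" unfolding f_def using q_pos by auto
    show "card (f ` {k*q..<k*q+q}) = card {0..<int q}" using card_image[OF inj] by simp
  qed auto
  then have "bij_betw f {k*q..<k*q+q} {0..<int q}" using inj unfolding bij_betw_def by blast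
  from sum.reindex_bij_betw[OF this, of chi]
  have "(\<Sum>i\<in>{k*q..<k*q+q}. chi (f i)) = 0" using sum_nonprincipal_character_period[OF char nonprincipal] by simp
  moreover have "chi (f i) = chi (int (Suc i))" for i
    by (rule dirichlet_character_cong[OF char]) (simp add: f_def add.commute)
  ultimately show ?thesis by simp
qed

text \<open>As the character sums to 0 over a block, y^(-s) can be subtracted from every power,
  \<open>y\<close> being the first integer of the block. Each of the \<open>q\<close> terms is then
  a difference over a distance of at most \<open>q\<close>, which explains q^2 and gains a factor
  1/y. The exponent involves \<open>c\<close> rather than Re s so that the bound is uniform in
  \<open>s\<close>.\<close>

lemma norm_block_le:
  assumes "0 < c" "c \<le> Re s"
  shows "norm (block k s) \<le> real q ^ 2 * norm s * real (Suc k) powr (-c - 1)"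
proof -
  define y where "y = real (Suc (k * q))"
  have "block k s = (\<Sum>i\<in>{k*q..<k*q+q}. chi (int (Suc i)) * (of_real (real (Suc i)) powr (-s)))"
    unfolding block_def dirichlet_term_def by (simp add: powr_minus field_simps del: of_nat_Suc)
  also have "\<dots> = (\<Sum>i\<in>{k*q..<k*q+q}. chi (int (Suc i)) * (of_real (real (Suc i)) powr (-s) - of_real y powr (-s)))"
    by (simp only: right_diff_distrib sum_subtractf sum_distrib_right[symmetric] sum_char_block mult_zero_left diff_zero)
  finally have "norm (block k s) \<le>
      (\<Sum>i\<in>{k*q..<k*q+q}. norm (chi (int (Suc i)) * (of_real (real (Suc i)) powr (-s) - of_real y powr (-s))))"
    by (simp only: norm_sum)
  also have "\<dots> \<le> (\<Sum>i\<in>{k*q..<k*q+q}. norm s * real (Suc k) powr (-c - 1) * real q)"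
  proof (rule sum_mono)
    fix i assume i: "i \<in> {k*q..<k*q+q}"
    have y: "y > 0" "y \<le> real (Suc i)" "real (Suc i) - y \<le> real q" using i unfolding y_def by (auto simp del: of_nat_mult)
    have "norm (chi (int (Suc i)) * (of_real (real (Suc i)) powr (-s) - of_real y powr (-s)))
      \<le> 1 * (norm s * y powr (-Re s - 1) * (real (Suc i) - y))"
      unfolding norm_mult
      by (intro mult_mono norm_powr_diff_le) (use y assms norm_dirichlet_character[OF char] in auto)
    also have "\<dots> \<le> norm s * y powr (-Re s - 1) * real q"
      using y by (simp add: mult_left_mono)
    also have "\<dots> \<le> norm s * real (Suc k) powr (-c - 1) * real q"
    proof (intro mult_right_mono mult_left_mono)
      have "Suc k \<le> Suc (k * q)" using q_pos by simp
      then have "real (Suc k) \<le> y" unfolding y_def by (rule of_nat_mono)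
      then have "y powr (-Re s - 1) \<le> real (Suc k) powr (-Re s - 1)"
        using assms by (intro powr_mono2') auto
      also have "\<dots> \<le> real (Suc k) powr (-c - 1)" using assms by (intro powr_mono) auto
      finally show "y powr (-Re s - 1) \<le> real (Suc k) powr (-c - 1)" .
    qed auto
    finally show "norm (chi (int (Suc i)) * (of_real (real (Suc i)) powr (-s) - of_real y powr (-s)))
      \<le> norm s * real (Suc k) powr (-c - 1) * real q" .
  qed
  also have "\<dots> = real q ^ 2 * norm s * real (Suc k) powr (-c - 1)"
    by (simp add: power2_eq_square)
  finally show ?thesis .
qed

lemma summable_block:
  assumes "Re s > 0"
  shows "summable (\<lambda>k. block k s)"
  by (rule summable_comparison_test'[of "\<lambda>k. real q ^ 2 * norm s * real (Suc k) powr (-Re s - 1)"])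
    (use assms in \<open>auto intro!: norm_block_le summable_mult summable_Suc_powr simp del: of_nat_Suc\<close>)

definition L where "L s = (\<Sum>k. block k s)"

lemma partial_sums_tendsto_L:
  assumes "Re s > 0"
  shows "(\<lambda>K. \<Sum>n<K*q. dirichlet_term chi s n) \<longlonglongrightarrow> L s"
  using summable_LIMSEQ[OF summable_block[OF assms]] unfolding L_def sum_block .

text \<open>Supplies the majorant for dominated convergence on the critical line: uniform in
  \<open>K\<close>, and integrable against the Gaussian since it grows only linearly in
  \<bar>t\<bar>. The series is the block bound with c = 1/2.\<close>

lemma norm_partial_sum_le:
  "norm (\<Sum>n<K*q. dirichlet_term chi (Complex (1/2) t) n) \<le>
    real q ^ 2 * (1 + \<bar>t\<bar>) * (\<Sum>k. real (Suc k) powr (-1/2 - 1))"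
proof -
  define s where "s = Complex (1/2) t"
  have "norm (\<Sum>k<K. block k s) \<le> (\<Sum>k<K. norm (block k s))" by (rule norm_sum)
  also have "\<dots> \<le> (\<Sum>k<K. real q ^ 2 * norm s * real (Suc k) powr (-(1/2) - 1))"
    by (intro sum_mono norm_block_le) (auto simp: s_def)
  also have "\<dots> = real q ^ 2 * norm s * (\<Sum>k<K. real (Suc k) powr (-1/2 - 1))"
    by (simp add: sum_distrib_left)
  also have "\<dots> \<le> real q ^ 2 * (1 + \<bar>t\<bar>) * (\<Sum>k. real (Suc k) powr (-1/2 - 1))"
  proof (intro mult_mono sum_le_suminf)
    show "summable (\<lambda>k. real (Suc k) powr (-1/2 - 1))" using summable_Suc_powr[of "1/2"] by simp
    show "norm s \<le> 1 + \<bar>t\<bar>" using cmod_le[of s] by (simp add: s_def)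
  qed (auto intro!: sum_nonneg)
  finally show ?thesis unfolding s_def sum_block .
qed

lemma L_holomorphic: "L holomorphic_on {s. Re s > 0}"
proof (rule holomorphic_uniform_sequence)
  show "open {s. Re s > 0}" by (rule open_halfspace_Re_gt)
  show "(\<lambda>s. \<Sum>k<n. block k s) holomorphic_on {s. Re s > 0}" for n
    unfolding block_def dirichlet_term_def by (intro holomorphic_intros) (auto simp del: of_nat_Suc)
  fix z :: complex assume z: "z \<in> {s. Re s > 0}"
  \<comment> \<open>With this radius the disc stays in Re s \<ge> d > 0, where the block bound holds
    with c = d.\<close>
  define d where "d = Re z / 2"
  have d: "d > 0" using z unfolding d_def by simp
  have b: "d \<le> Re s \<and> norm s \<le> norm z + d" if "s \<in> cball z d" for s
  proof -
    have "norm (z - s) \<le> d" using that by (simp add: dist_norm)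
    moreover have "\<bar>Re z - Re s\<bar> \<le> norm (z - s)" using abs_Re_le_cmod[of "z - s"] by simp
    moreover have "norm s \<le> norm z + norm (z - s)" using norm_triangle_sub[of s z] by (simp add: norm_minus_commute)
    ultimately show ?thesis unfolding d_def by (auto simp: abs_if split: if_splits)
  qed
  show "\<exists>d. 0 < d \<and> cball z d \<subseteq> {s. Re s > 0} \<and>
      uniform_limit (cball z d) (\<lambda>n s. \<Sum>k<n. block k s) L sequentially"
  proof (intro exI[of _ d] conjI)
    show "0 < d" by (rule d)
    show "cball z d \<subseteq> {s. Re s > 0}" using b d by force
    show "uniform_limit (cball z d) (\<lambda>n s. \<Sum>k<n. block k s) L sequentially"
      unfolding L_def
    proof (rule Weierstrass_m_test)
      fix k s assume s: "s \<in> cball z d"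
      have "norm (block k s) \<le> real q ^ 2 * norm s * real (Suc k) powr (-d - 1)"
        by (rule norm_block_le) (use b[OF s] d in auto)
      also have "\<dots> \<le> real q ^ 2 * (norm z + d) * real (Suc k) powr (-d - 1)"
        by (intro mult_right_mono mult_left_mono) (use b[OF s] in auto)
      finally show "norm (block k s) \<le> real q ^ 2 * (norm z + d) * real (Suc k) powr (-d - 1)" .
    qed (use d in \<open>intro summable_mult summable_Suc_powr\<close>)
  qed
qed

text \<open>For Re s > 1 the ungrouped series converges absolutely, and the sums over blocks are the
  subsequence of its partial sums at multiples of \<open>q\<close>.\<close>

lemma L_eq_dirichlet_series:
  assumes "Re s > 1"
  shows "L s = dirichlet_series chi s"
proof -
  have "summable (\<lambda>n. dirichlet_term chi s n)"
  proof (rule summable_comparison_test')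
    show "summable (\<lambda>n. real (Suc n) powr (-(Re s - 1) - 1))" using assms by (intro summable_Suc_powr) auto
    show "norm (dirichlet_term chi s n) \<le> real (Suc n) powr (-(Re s - 1) - 1)" for n
      using norm_dirichlet_character[OF char, of "int (Suc n)"] norm_powr_real_powr[of "of_nat (Suc n)" s]
      by (auto simp: dirichlet_term_def norm_divide powr_minus_divide simp del: of_nat_Suc)
  qed
  then have "(\<lambda>K. \<Sum>n<K. dirichlet_term chi s n) \<longlonglongrightarrow> dirichlet_series chi s"
    unfolding dirichlet_series_def dirichlet_term_def by (rule summable_LIMSEQ)
  then have "((\<lambda>K. \<Sum>n<K. dirichlet_term chi s n) \<circ> (\<lambda>K. K * q)) \<longlonglongrightarrow> dirichlet_series chi s"
    by (rule LIMSEQ_subseq_LIMSEQ) (use q_pos in \<open>auto simp: strict_mono_def\<close>)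
  then show ?thesis using partial_sums_tendsto_L[of s] assms LIMSEQ_unique unfolding o_def by force
qed

text \<open>Any competing continuation agrees with \<open>L\<close> for Re w > max 1 \<sigma>, hence
  on the connected half-plane Re w > max 0 \<sigma>, which still contains \<open>s\<close>.\<close>

lemma dirichlet_L_eq:
  assumes "Re s > 0"
  shows "dirichlet_L q chi s = L s"
  unfolding dirichlet_L_def
proof (rule the_equality)
  show "\<exists>\<sigma> f. \<sigma> < Re s \<and>
        f holomorphic_on {w. Re w > \<sigma>} - (if chi = principal_character q then {1} else {}) \<and>
        (\<forall>w. Re w > 1 \<longrightarrow> f w = dirichlet_series chi w) \<and> L s = f s"
    using nonprincipal L_holomorphic L_eq_dirichlet_series assms by (intro exI[of _ 0] exI[of _ L]) auto
  fix z assume "\<exists>\<sigma> f. \<sigma> < Re s \<and>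
        f holomorphic_on {w. Re w > \<sigma>} - (if chi = principal_character q then {1} else {}) \<and>
        (\<forall>w. Re w > 1 \<longrightarrow> f w = dirichlet_series chi w) \<and> z = f s"
  then obtain \<sigma> f where f: "\<sigma> < Re s" "f holomorphic_on {w. Re w > \<sigma>}"
    "\<And>w. Re w > 1 \<Longrightarrow> f w = dirichlet_series chi w" "z = f s"
    using nonprincipal by auto
  have "f s = L s"
  proof (rule analytic_continuation_open[where f = f and g = L, of "{w. Re w > max 1 \<sigma>}" "{w. Re w > max 0 \<sigma>}"])
    show "{w. Re w > max 1 \<sigma>} \<noteq> {}"
      by (intro ex_in_conv[THEN iffD1] exI[of _ "of_real (max 1 \<sigma> + 1)"]) auto
    show "open {w. Re w > max 1 \<sigma>}" "open {w. Re w > max 0 \<sigma>}" by (rule open_halfspace_Re_gt)+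
    show "connected {w. Re w > max 0 \<sigma>}" by (intro convex_connected convex_halfspace_Re_gt)
    show "f holomorphic_on {w. Re w > max 0 \<sigma>}" by (rule holomorphic_on_subset[OF f(2)]) auto
    show "L holomorphic_on {w. Re w > max 0 \<sigma>}" by (rule holomorphic_on_subset[OF L_holomorphic]) auto
  qed (use f assms L_eq_dirichlet_series in auto)
  then show "z = L s" using f by simp
qed

end

section \<open>The Gaussian weight and its character sums\<close>

text \<open>A Gaussian in \<open>ln x\<close> is its own transform: on the line \<open>Re s = 1/2\<close> the weight is an average
  of \<open>M powr (\<i> * t) / x powr s\<close> over a standard normal \<open>t\<close>. As the partial sums of the Dirichlet
  series are already \<open>O(1 + \<bar>t\<bar>)\<close> on this line, no shift of contour is needed below.\<close>

definition log_gauss :: "real \<Rightarrow> real \<Rightarrow> real" where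
  "log_gauss M x = exp (- (ln (M / x))\<^sup>2 / 2) / sqrt x"

lemma log_gauss_nonneg: "x \<ge> 0 \<Longrightarrow> log_gauss M x \<ge> 0"
  unfolding log_gauss_def by simp

text \<open>From (u + 2)^2 \<ge> 0 with u = ln (M / x) the Gaussian is at most e^2 (M / x)^2. This
  crude decay is what makes the weight summable over the integers.\<close>

lemma log_gauss_le:
  assumes "M > 0" "x \<ge> 1"
  shows "log_gauss M x \<le> exp 2 * M\<^sup>2 / x\<^sup>2"
proof -
  define u where "u = ln (M / x)"
  have "0 \<le> (u + 2)\<^sup>2 / 2" by simp
  then have "- u\<^sup>2 / 2 \<le> 2 + 2 * u" by (simp add: power2_eq_square algebra_simps add_divide_distrib)
  then have "exp (- u\<^sup>2 / 2) \<le> exp (2 + 2 * u)" by simp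
  also have "\<dots> = exp 2 * exp u ^ 2" by (simp only: exp_add exp_double)
  also have "exp u = M / x" unfolding u_def using assms by simp
  finally have "exp (- u\<^sup>2 / 2) \<le> exp 2 * M\<^sup>2 / x\<^sup>2" by (simp add: power_divide)
  moreover have "log_gauss M x \<le> exp (- u\<^sup>2 / 2)"
  proof -
    have "exp (- u\<^sup>2 / 2) / sqrt x \<le> exp (- u\<^sup>2 / 2) / 1"
      using assms by (intro divide_left_mono) auto
    then show ?thesis unfolding log_gauss_def u_def by simp
  qed
  ultimately show ?thesis by linarith
qed

lemma summable_inverse_Suc_squares: "summable (\<lambda>n. 1 / (real (Suc n))\<^sup>2)"
  using inverse_squares_sums sums_summable by simp

lemma summable_log_gauss:
  assumes "M > 0"
  shows "summable (\<lambda>n. log_gauss M (real (Suc n)))"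
proof (rule summable_comparison_test')
  show "summable (\<lambda>n. exp 2 * M\<^sup>2 * (1 / (real (Suc n))\<^sup>2))"
    by (intro summable_mult summable_inverse_Suc_squares)
  show "norm (log_gauss M (real (Suc n))) \<le> exp 2 * M\<^sup>2 * (1 / (real (Suc n))\<^sup>2)" for n
    using log_gauss_le[OF assms, of "real (Suc n)"] log_gauss_nonneg[of "real (Suc n)" M] by simp
qed

text \<open>With m = n + 1 and u = ln (M / m) the integrand is m^(-1/2) e^(itu), so the average over
  \<open>t\<close> is m^(-1/2) times the characteristic function of the normal law at
  \<open>u\<close>, namely e^(-u^2/2).\<close>

lemma log_gauss_eq_integral:
  assumes "M > 0"
  shows "complex_of_real (log_gauss M (real (Suc n))) =
    (LINT t|std_normal_distribution. cis (t * ln M) * (1 / of_nat (Suc n) powr Complex (1/2) t))"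
    and "integrable std_normal_distribution (\<lambda>t. cis (t * ln M) * (1 / of_nat (Suc n) powr Complex (1/2) t))"
proof -
  interpret real_distribution std_normal_distribution by (rule real_dist_normal_dist)
  define m where "m = real (Suc n)"
  have m: "m > 0" unfolding m_def by simp
  define u where "u = ln (M / m)"
  have eq: "cis (t * ln M) * (1 / of_nat (Suc n) powr Complex (1/2) t) = complex_of_real (1 / sqrt m) * iexp (u * t)" for t
  proof -
    have "of_nat (Suc n) powr Complex (1/2) t = exp (Complex (1/2) t * of_real (ln m))"
      unfolding m_def by (subst powr_def) (simp add: Ln_of_nat del: of_nat_Suc)
    also have "Complex (1/2) t * of_real (ln m) = of_real (ln m / 2) + \<i> * of_real (t * ln m)"
      by (simp add: complex_eq_iff)
    also have "exp \<dots> = of_real (exp (ln m / 2)) * cis (t * ln m)"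
      unfolding exp_add cis_conv_exp exp_of_real ..
    also have "\<dots> = of_real (sqrt m) * cis (t * ln m)"
    proof -
      have "exp (ln m / 2) = exp (ln (sqrt m))" using m by (simp only: ln_sqrt)
      then show ?thesis using m by simp
    qed
    finally have X: "of_nat (Suc n) powr Complex (1/2) t = of_real (sqrt m) * cis (t * ln m)" .
    have "1 / of_nat (Suc n) powr Complex (1/2) t = complex_of_real (1 / sqrt m) * cis (- (t * ln m))"
      unfolding X by (simp only: divide_inverse inverse_mult_distrib cis_inverse mult_1_left of_real_inverse)
    then have "cis (t * ln M) * (1 / of_nat (Suc n) powr Complex (1/2) t)
        = complex_of_real (1 / sqrt m) * (cis (t * ln M) * cis (- (t * ln m)))"
      by (simp only: mult.left_commute)
    also have "cis (t * ln M) * cis (- (t * ln m)) = cis (t * ln M - t * ln m)"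
      by (simp only: cis_mult diff_conv_add_uminus)
    also have "t * ln M - t * ln m = u * t" 
    proof -
      have "u = ln M - ln m" unfolding u_def using assms m by (simp add: ln_div)
      then have "ln M = u + ln m" by simp
      then show ?thesis by (simp add: algebra_simps)
    qed
    finally show ?thesis by (simp add: cis_conv_exp)
  qed
  have "(LINT t|std_normal_distribution. cis (t * ln M) * (1 / of_nat (Suc n) powr Complex (1/2) t))
     = complex_of_real (1 / sqrt m) * char std_normal_distribution u"
    unfolding eq char_def by (rule integral_mult_right_zero)
  also have "\<dots> = complex_of_real (log_gauss M m)"
  proof -
    have "log_gauss M m = 1 / sqrt m * exp (- (u\<^sup>2) / 2)"
      unfolding log_gauss_def u_def by simp
    then show ?thesis unfolding char_std_normal_distribution of_real_mult[symmetric] by (simp only:)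
  qed
  finally show "complex_of_real (log_gauss M (real (Suc n))) =
    (LINT t|std_normal_distribution. cis (t * ln M) * (1 / of_nat (Suc n) powr Complex (1/2) t))"
    unfolding m_def by simp
  show "integrable std_normal_distribution (\<lambda>t. cis (t * ln M) * (1 / of_nat (Suc n) powr Complex (1/2) t))"
    unfolding eq by (rule integrable_mult_right[OF integrable_iexp]) auto
qed

text \<open>A partial sum of the weighted series is the Gaussian average of a partial Dirichlet sum
  times a factor of modulus 1. After taking norms, dominated convergence replaces the partial
  Dirichlet sum by \<open>L\<close>, which is bounded pointwise by \<open>GLH\<close>. All partial
  sums end at multiples of \<open>q\<close>, where the majorant is available.\<close>

lemma (in nonprincipal_character) norm_log_gauss_sum_le:
  assumes GLH: "\<And>t. norm (dirichlet_L q chi (Complex (1/2) t)) \<le> C * (real q * (\<bar>t\<bar> + 1)) powr \<delta>"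
    and \<delta>: "\<delta> \<le> 1" and C: "C \<ge> 0" and M: "M > 0"
  shows "norm (\<Sum>n. chi (int (Suc n)) * of_real (log_gauss M (real (Suc n)))) \<le>
    C * (LINT t|std_normal_distribution. \<bar>t\<bar> + 1) * real q powr \<delta>"
proof -
  interpret real_distribution std_normal_distribution by (rule real_dist_normal_dist)
  define P where "P = (\<lambda>K t. \<Sum>n<K*q. dirichlet_term chi (Complex (1/2) t) n)"
  define A where "A = (\<lambda>K. \<Sum>n<K*q. chi (int (Suc n)) * complex_of_real (log_gauss M (real (Suc n))))"
  define T where "T = (\<Sum>n. chi (int (Suc n)) * complex_of_real (log_gauss M (real (Suc n))))"
  define w where "w = (\<lambda>t. real q ^ 2 * (1 + \<bar>t\<bar>) * (\<Sum>k. real (Suc k) powr (-1/2 - 1)))"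
  have int_abs: "integrable std_normal_distribution (\<lambda>t. \<bar>t\<bar> + 1)"
    using integrable_std_normal_distribution_moment[of 1] by (intro Bochner_Integration.integrable_add integrable_abs) auto
  have int_w: "integrable std_normal_distribution w"
    unfolding w_def using int_abs by (intro integrable_mult_left integrable_mult_right) (simp add: add.commute)
  define g where "g = (\<lambda>n t. cis (t * ln M) * (1 / complex_of_nat (Suc n) powr Complex (1/2) t))"
  have int_term: "integrable std_normal_distribution (\<lambda>t. chi (int (Suc n)) * g n t)" for n
    unfolding g_def by (intro integrable_mult_right log_gauss_eq_integral(2) M)
  have g_eq: "(LINT t|std_normal_distribution. chi (int (Suc n)) * g n t) = chi (int (Suc n)) * log_gauss M (real (Suc n))" for n
    unfolding g_def log_gauss_eq_integral(1)[OF M] by (rule integral_mult_right_zero)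
  have P_eq: "cis (t * ln M) * P K t = (\<Sum>n<K*q. chi (int (Suc n)) * g n t)" for K t
    unfolding P_def dirichlet_term_def g_def by (simp add: sum_distrib_left mult_ac)
  have A_eq: "A K = (LINT t|std_normal_distribution. cis (t * ln M) * P K t)" for K
    unfolding A_def P_eq using int_term
    by (subst Bochner_Integration.integral_sum) (simp_all only: g_eq)
  have int_P: "integrable std_normal_distribution (\<lambda>t. cis (t * ln M) * P K t)" for K
    unfolding P_eq by (intro Bochner_Integration.integrable_sum int_term)
  have norm_P: "norm (cis (t * ln M) * P K t) = norm (P K t)" for K t by (simp add: norm_mult)
  have int_nP: "integrable std_normal_distribution (\<lambda>t. norm (P K t))" for K
    using integrable_norm[OF int_P[of K]] unfolding norm_P .
  have A_le: "norm (A K) \<le> (LINT t|std_normal_distribution. norm (P K t))" for K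
    unfolding A_eq using integral_norm_bound[of std_normal_distribution "\<lambda>t. cis (t * ln M) * P K t"] unfolding norm_P .
  have P_lim: "(\<lambda>K. norm (P K t)) \<longlonglongrightarrow> norm (L (Complex (1/2) t))" for t
    unfolding P_def by (intro tendsto_norm partial_sums_tendsto_L) simp
  have meas: "(\<lambda>t. norm (P K t)) \<in> borel_measurable std_normal_distribution" for K
    using int_nP by (rule borel_measurable_integrable)
  have measL: "(\<lambda>t. norm (L (Complex (1/2) t))) \<in> borel_measurable std_normal_distribution"
    by (rule borel_measurable_LIMSEQ_metric[OF meas P_lim])
  have bound: "norm (norm (P K t)) \<le> w t" for K t
    using norm_partial_sum_le unfolding P_def w_def by simp
  have lim: "(\<lambda>K. LINT t|std_normal_distribution. norm (P K t)) \<longlonglongrightarrow>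
      (LINT t|std_normal_distribution. norm (L (Complex (1/2) t)))"
    by (rule integral_dominated_convergence[where w = w]) (use meas measL int_w P_lim bound in auto)
  have int_L: "integrable std_normal_distribution (\<lambda>t. norm (L (Complex (1/2) t)))"
    by (rule integrable_dominated_convergence[where w = w and s = "\<lambda>K t. norm (P K t)"])
      (use meas measL int_w P_lim bound in auto)
  have "summable (\<lambda>n. chi (int (Suc n)) * complex_of_real (log_gauss M (real (Suc n))))"
  proof (rule summable_comparison_test'[OF summable_log_gauss[OF M]])
    fix n show "norm (chi (int (Suc n)) * complex_of_real (log_gauss M (real (Suc n)))) \<le> log_gauss M (real (Suc n))"
      using norm_dirichlet_character[OF char, of "int (Suc n)"] log_gauss_nonneg[of "real (Suc n)" M]
      by (auto simp: norm_mult simp del: of_nat_Suc)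
  qed
  then have "(\<lambda>K. \<Sum>n<K. chi (int (Suc n)) * complex_of_real (log_gauss M (real (Suc n)))) \<longlonglongrightarrow> T"
    unfolding T_def by (rule summable_LIMSEQ)
  then have "((\<lambda>K. \<Sum>n<K. chi (int (Suc n)) * complex_of_real (log_gauss M (real (Suc n)))) \<circ> (\<lambda>K. K * q)) \<longlonglongrightarrow> T"
    by (rule LIMSEQ_subseq_LIMSEQ) (use q_pos in \<open>auto simp: strict_mono_def\<close>)
  then have "A \<longlonglongrightarrow> T" unfolding A_def o_def .
  then have "norm T \<le> (LINT t|std_normal_distribution. norm (L (Complex (1/2) t)))"
    using A_le by (intro LIMSEQ_le[OF tendsto_norm lim]) auto
  also have "\<dots> \<le> (LINT t|std_normal_distribution. C * real q powr \<delta> * (\<bar>t\<bar> + 1))"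
  proof (rule integral_mono[OF int_L])
    show "integrable std_normal_distribution (\<lambda>t. C * real q powr \<delta> * (\<bar>t\<bar> + 1))"
      by (intro integrable_mult_right int_abs)
    fix t
    have "norm (L (Complex (1/2) t)) \<le> C * (real q * (\<bar>t\<bar> + 1)) powr \<delta>"
      using GLH[of t] dirichlet_L_eq[of "Complex (1/2) t"] by simp
    also have "\<dots> = C * real q powr \<delta> * (\<bar>t\<bar> + 1) powr \<delta>" by (simp add: powr_mult)
    \<comment> \<open>Raising the exponent of \<bar>t\<bar> + 1 to 1 makes the integral over
      \<open>t\<close> an absolute constant.\<close>
    also have "\<dots> \<le> C * real q powr \<delta> * (\<bar>t\<bar> + 1) powr 1"
      using \<delta> C by (intro mult_left_mono powr_mono) auto
    finally show "norm (L (Complex (1/2) t)) \<le> C * real q powr \<delta> * (\<bar>t\<bar> + 1)" by simp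
  qed
  also have "\<dots> = C * (LINT t|std_normal_distribution. \<bar>t\<bar> + 1) * real q powr \<delta>"
    by (simp del: Bochner_Integration.integral_add)
  finally show ?thesis unfolding T_def .
qed

section \<open>Products of two primes in a residue class\<close>

text \<open>Within one residue class a number is determined by its quotient by \<open>q\<close>,
  which is at most N / q.\<close>

lemma card_cong_le:
  fixes N :: real
  assumes q: "q > 0" and P: "finite P" "\<And>p. p \<in> P \<Longrightarrow> real p \<le> N" and N: "N \<ge> 0"
  shows "real (card {p'\<in>P. [int p = int p'] (mod int q)}) \<le> N / real q + 1"
proof -
  define S where "S = {p'\<in>P. [int p = int p'] (mod int q)}"
  have "inj_on (\<lambda>p'. p' div q) S"
  proof (rule inj_onI)
    fix x y assume xy: "x \<in> S" "y \<in> S" "x div q = y div q"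
    then have "[int x = int y] (mod int q)" unfolding S_def by (metis (mono_tags, lifting) cong_sym cong_trans mem_Collect_eq)
    then have "x mod q = y mod q" by (simp add: cong_int_iff) (simp add: cong_def)
    then show "x = y" using xy(3) by (metis div_mult_mod_eq)
  qed
  moreover have "(\<lambda>p'. p' div q) ` S \<subseteq> {..nat \<lfloor>N / real q\<rfloor>}"
  proof safe
    fix x assume "x \<in> S"
    then have "real x \<le> N" using P unfolding S_def by blast
    have "real (x div q) \<le> real x / real q" by (rule of_nat_div_le_of_nat)
    also have "\<dots> \<le> N / real q" using \<open>real x \<le> N\<close> by (simp add: divide_right_mono)
    finally show "x div q \<le> nat \<lfloor>N / real q\<rfloor>" by (simp add: le_nat_floor)
  qed
  ultimately have "card S \<le> card {..nat \<lfloor>N / real q\<rfloor>}"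
    using card_inj_on_le by blast
  then have "real (card S) \<le> real (nat \<lfloor>N / real q\<rfloor>) + 1" by simp
  also have "real (nat \<lfloor>N / real q\<rfloor>) \<le> N / real q" using N by (intro of_nat_floor) simp
  finally show ?thesis unfolding S_def by simp
qed

text \<open>Opening the square and summing over the characters leaves the pairs congruent modulo
  \<open>q\<close>; each \<open>p\<close> has at most N / q + 1 partners in \<open>P\<close>, itself
  included.\<close>

lemma character_mean_square_le:
  fixes N :: real
  assumes q: "q > 0" and P: "finite P" "\<And>p. p \<in> P \<Longrightarrow> real p \<le> N"
    "\<And>p. p \<in> P \<Longrightarrow> coprime (int p) (int q)" and N: "N \<ge> 0"
  shows "(\<Sum>chi | dirichlet_character q chi. norm (\<Sum>p\<in>P. chi (int p)) ^ 2) \<le>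
    real (card {chi. dirichlet_character q chi}) * real (card P) * (N / real q + 1)"
proof -
  define X where "X = {chi. dirichlet_character q chi}"
  have "complex_of_real (\<Sum>chi\<in>X. norm (\<Sum>p\<in>P. chi (int p)) ^ 2) =
      (\<Sum>chi\<in>X. (\<Sum>p\<in>P. cnj (chi (int p))) * (\<Sum>p'\<in>P. chi (int p')))"
    unfolding of_real_sum complex_norm_square cnj_sum by (simp add: mult.commute)
  also have "\<dots> = (\<Sum>chi\<in>X. \<Sum>p\<in>P. \<Sum>p'\<in>P. cnj (chi (int p)) * chi (int p'))"
    by (simp add: sum_product)
  also have "\<dots> = (\<Sum>p\<in>P. \<Sum>chi\<in>X. \<Sum>p'\<in>P. cnj (chi (int p)) * chi (int p'))"
    by (rule sum.swap)
  also have "\<dots> = (\<Sum>p\<in>P. \<Sum>p'\<in>P. \<Sum>chi\<in>X. cnj (chi (int p)) * chi (int p'))"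
    by (intro sum.cong refl sum.swap)
  also have "\<dots> = (\<Sum>p\<in>P. \<Sum>p'\<in>P. if [int p = int p'] (mod int q) then of_nat (card X) else 0)"
    unfolding X_def using q P by (intro sum.cong refl sum_cnj_dirichlet_characters) auto
  also have "\<dots> = (\<Sum>p\<in>P. of_nat (card X) * of_nat (card {p'\<in>P. [int p = int p'] (mod int q)}))"
    using P by (intro sum.cong refl) (simp add: sum.If_cases Int_def)
  also have "\<dots> = complex_of_real (\<Sum>p\<in>P. real (card X) * real (card {p'\<in>P. [int p = int p'] (mod int q)}))"
    by simp
  finally have "(\<Sum>chi\<in>X. norm (\<Sum>p\<in>P. chi (int p)) ^ 2) =
      (\<Sum>p\<in>P. real (card X) * real (card {p'\<in>P. [int p = int p'] (mod int q)}))"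
    by (simp only: of_real_eq_iff)
  also have "\<dots> \<le> (\<Sum>p\<in>P. real (card X) * (N / real q + 1))"
    by (intro sum_mono mult_left_mono card_cong_le q P N) auto
  also have "\<dots> = real (card X) * real (card P) * (N / real q + 1)" by simp
  finally show ?thesis unfolding X_def .
qed

text \<open>The product of the two prime sums is split by 2xy \<le> x^2 + y^2. This is as good as
  Cauchy-Schwarz, since both sets have \<open>K\<close> elements and hence the same mean square
  bound. By positivity the principal character may be put back before the mean square is
  applied.\<close>

lemma norm_sum_nonprincipal_le:
  fixes T :: "(int \<Rightarrow> complex) \<Rightarrow> complex"
  assumes q: "q > 0" and N: "N \<ge> 0" and a: "coprime a (int q)" and B: "B \<ge> 0"
    and P1: "finite P1" "\<And>p. p \<in> P1 \<Longrightarrow> real p \<le> N" "\<And>p. p \<in> P1 \<Longrightarrow> coprime (int p) (int q)" "card P1 = K"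
    and P2: "finite P2" "\<And>p. p \<in> P2 \<Longrightarrow> real p \<le> N" "\<And>p. p \<in> P2 \<Longrightarrow> coprime (int p) (int q)" "card P2 = K"
    and T: "\<And>chi. dirichlet_character q chi \<Longrightarrow> chi \<noteq> principal_character q \<Longrightarrow> norm (T chi) \<le> B"
  defines "X \<equiv> {chi. dirichlet_character q chi}"
  shows "norm (\<Sum>chi\<in>X - {principal_character q}.
      cnj (chi a * (\<Sum>p\<in>P1. chi (int p)) * (\<Sum>p\<in>P2. chi (int p))) * T chi)
    \<le> B * real (card X) * real K * (N / real q + 1)"
proof -
  define S1 where "S1 = (\<lambda>chi::int \<Rightarrow> complex. norm (\<Sum>p\<in>P1. chi (int p)))"
  define S2 where "S2 = (\<lambda>chi::int \<Rightarrow> complex. norm (\<Sum>p\<in>P2. chi (int p)))"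
  have fin: "finite X" unfolding X_def by (rule finite_dirichlet_characters)
  have "norm (\<Sum>chi\<in>X - {principal_character q}.
      cnj (chi a * (\<Sum>p\<in>P1. chi (int p)) * (\<Sum>p\<in>P2. chi (int p))) * T chi)
    \<le> (\<Sum>chi\<in>X - {principal_character q}. B * ((S1 chi ^ 2 + S2 chi ^ 2) / 2))"
  proof (rule sum_norm_le)
    fix chi assume "chi \<in> X - {principal_character q}"
    then have chi: "dirichlet_character q chi" "chi \<noteq> principal_character q" unfolding X_def by auto
    have "0 \<le> (S1 chi - S2 chi) ^ 2" by simp
    then have amgm: "S1 chi * S2 chi \<le> (S1 chi ^ 2 + S2 chi ^ 2) / 2"
      by (simp add: power2_diff)
    have "norm (cnj (chi a * (\<Sum>p\<in>P1. chi (int p)) * (\<Sum>p\<in>P2. chi (int p))) * T chi)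
        = S1 chi * S2 chi * norm (T chi)"
      unfolding norm_mult complex_mod_cnj S1_def S2_def
      using norm_dirichlet_character[OF chi(1), of a] a by simp
    also have "\<dots> \<le> (S1 chi ^ 2 + S2 chi ^ 2) / 2 * B"
      by (intro mult_mono amgm T chi) auto
    finally show "norm (cnj (chi a * (\<Sum>p\<in>P1. chi (int p)) * (\<Sum>p\<in>P2. chi (int p))) * T chi)
        \<le> B * ((S1 chi ^ 2 + S2 chi ^ 2) / 2)" by (simp add: mult.commute)
  qed
  also have "\<dots> \<le> (\<Sum>chi\<in>X. B * ((S1 chi ^ 2 + S2 chi ^ 2) / 2))"
    by (intro sum_mono2 fin) (use B in auto)
  also have "\<dots> = B * (((\<Sum>chi\<in>X. S1 chi ^ 2) + (\<Sum>chi\<in>X. S2 chi ^ 2)) / 2)"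
    by (simp add: sum_distrib_left[symmetric] sum_divide_distrib[symmetric] sum.distrib[symmetric])
  also have "\<dots> \<le> B * ((real (card X) * real K * (N / real q + 1) + real (card X) * real K * (N / real q + 1)) / 2)"
  proof (intro mult_left_mono divide_right_mono add_mono B)
    show "(\<Sum>chi\<in>X. S1 chi ^ 2) \<le> real (card X) * real K * (N / real q + 1)"
      using character_mean_square_le[OF q P1(1-3) N] unfolding X_def S1_def P1(4) by simp
    show "(\<Sum>chi\<in>X. S2 chi ^ 2) \<le> real (card X) * real K * (N / real q + 1)"
      using character_mean_square_le[OF q P2(1-3) N] unfolding X_def S2_def P2(4) by simp
  qed auto
  also have "\<dots> = B * real (card X) * real K * (N / real q + 1)" by simp
  finally show ?thesis .
qed

text \<open>The sum of c(chi) T(chi) over all characters is their number times the weighted count of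
  solutions. If there is no solution up to \<open>Y\<close>, only the tail of the weight is left;
  isolating the principal character then bounds K^2 W by the tail part plus the nonprincipal part.
  Dividing by \<open>K\<close> and using that there are at most \<open>q\<close> characters
  contradicts \<open>large\<close>.\<close>

lemma exists_product_in_residue_class:
  fixes w :: "nat \<Rightarrow> real"
  assumes q: "q > 0" and N: "N \<ge> 0" and a: "coprime a (int q)" and B: "B \<ge> 0"
    and P1: "finite P1" "\<And>p. p \<in> P1 \<Longrightarrow> real p \<le> N" "\<And>p. p \<in> P1 \<Longrightarrow> coprime (int p) (int q)" "card P1 = K"
    and P2: "finite P2" "\<And>p. p \<in> P2 \<Longrightarrow> real p \<le> N" "\<And>p. p \<in> P2 \<Longrightarrow> coprime (int p) (int q)" "card P2 = K"
    and K: "K > 0"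
    and w: "\<And>n. w n \<ge> 0" "summable w"
    and T: "\<And>chi. dirichlet_character q chi \<Longrightarrow> chi \<noteq> principal_character q \<Longrightarrow>
       norm (\<Sum>n. chi (int (Suc n)) * of_real (w n)) \<le> B"
    and W: "W \<le> (\<Sum>n. if coprime (int (Suc n)) (int q) then w n else 0)"
    and large: "real q * real K * (\<Sum>n. if real (Suc n) > Y then w n else 0) + B * (N + real q) < real K * W"
  shows "\<exists>p1\<in>P1. \<exists>p2\<in>P2. \<exists>n. real (Suc n) \<le> Y \<and> [a * int p1 * int p2 = int (Suc n)] (mod int q)"
proof (rule ccontr)
  assume none: "\<not> ?thesis"
  define X where "X = {chi. dirichlet_character q chi}"
  define h where "h = card X"
  define T where "T = (\<lambda>chi::int \<Rightarrow> complex. \<Sum>n. chi (int (Suc n)) * of_real (w n))"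
  define tail where "tail = (\<lambda>n. if real (Suc n) > Y then w n else 0)"
  define c where "c = (\<lambda>chi::int \<Rightarrow> complex. cnj (chi a * (\<Sum>p\<in>P1. chi (int p)) * (\<Sum>p\<in>P2. chi (int p))))"
  have fin: "finite X" unfolding X_def by (rule finite_dirichlet_characters)
  have prin: "principal_character q \<in> X" unfolding X_def using principal_dirichlet_character q by blast
  have h: "h \<le> q" unfolding h_def X_def by (rule card_dirichlet_characters_le) fact
  have summ: "summable (\<lambda>n. chi (int (Suc n)) * complex_of_real (w n))" if "chi \<in> X" for chi
  proof (rule summable_comparison_test'[OF w(2)])
    fix n show "norm (chi (int (Suc n)) * complex_of_real (w n)) \<le> w n"
      using norm_dirichlet_character[of q chi "int (Suc n)"] that w(1)[of n] unfolding X_def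
      by (auto simp: norm_mult simp del: of_nat_Suc)
  qed
  have summ_tail: "summable tail"
    by (rule summable_comparison_test'[OF w(2)]) (use w(1) in \<open>auto simp: tail_def\<close>)

  have expand: "(\<Sum>chi\<in>X. c chi * chi (int (Suc n))) =
     (\<Sum>p1\<in>P1. \<Sum>p2\<in>P2. if [a * int p1 * int p2 = int (Suc n)] (mod int q) then of_nat h else 0)" for n
  proof -
    have "c chi * chi (int (Suc n)) = (\<Sum>p1\<in>P1. \<Sum>p2\<in>P2. cnj (chi (a * int p1 * int p2)) * chi (int (Suc n)))"
      if "chi \<in> X" for chi
    proof -
      have m: "chi (x * y) = chi x * chi y" for x y using that dirichlet_character_mult unfolding X_def by blast
      show ?thesis unfolding c_def m by (simp add: sum_product sum_distrib_left sum_distrib_right mult_ac)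
    qed
    then have "(\<Sum>chi\<in>X. c chi * chi (int (Suc n))) =
       (\<Sum>chi\<in>X. \<Sum>p1\<in>P1. \<Sum>p2\<in>P2. cnj (chi (a * int p1 * int p2)) * chi (int (Suc n)))"
      by (intro sum.cong refl)
    also have "\<dots> = (\<Sum>p1\<in>P1. \<Sum>chi\<in>X. \<Sum>p2\<in>P2. cnj (chi (a * int p1 * int p2)) * chi (int (Suc n)))"
      by (rule sum.swap)
    also have "\<dots> = (\<Sum>p1\<in>P1. \<Sum>p2\<in>P2. \<Sum>chi\<in>X. cnj (chi (a * int p1 * int p2)) * chi (int (Suc n)))"
      by (intro sum.cong refl sum.swap)
    also have "\<dots> = (\<Sum>p1\<in>P1. \<Sum>p2\<in>P2. if [a * int p1 * int p2 = int (Suc n)] (mod int q) then of_nat h else 0)"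
      unfolding h_def X_def using a P1(3) P2(3) by (intro sum.cong refl sum_cnj_dirichlet_characters q) auto
    finally show ?thesis .
  qed
  have "(\<lambda>n. \<Sum>chi\<in>X. c chi * (chi (int (Suc n)) * complex_of_real (w n))) sums (\<Sum>chi\<in>X. c chi * T chi)"
    unfolding T_def by (intro sums_sum sums_mult summable_sums summ)
  also have "(\<lambda>n. \<Sum>chi\<in>X. c chi * (chi (int (Suc n)) * complex_of_real (w n))) =
      (\<lambda>n. (\<Sum>chi\<in>X. c chi * chi (int (Suc n))) * complex_of_real (w n))"
    by (simp add: sum_distrib_right mult.assoc)
  finally have sums: "(\<lambda>n. (\<Sum>chi\<in>X. c chi * chi (int (Suc n))) * complex_of_real (w n)) sums (\<Sum>chi\<in>X. c chi * T chi)" .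
  \<comment> \<open>Beyond \<open>Y\<close> at most all K^2 pairs of primes contribute; up to
    \<open>Y\<close> every term vanishes by \<open>none\<close>.\<close>
  have term_le: "norm ((\<Sum>chi\<in>X. c chi * chi (int (Suc n))) * complex_of_real (w n)) \<le> real h * real K ^ 2 * tail n" for n
  proof (cases "real (Suc n) > Y")
    case True
    have "norm (\<Sum>chi\<in>X. c chi * chi (int (Suc n))) \<le> (\<Sum>p1\<in>P1. \<Sum>p2\<in>P2. real h)"
      unfolding expand by (intro sum_norm_le) auto
    also have "\<dots> = real h * real K ^ 2" using P1(4) P2(4) by (simp add: power2_eq_square)
    finally show ?thesis using True w(1)[of n] by (simp add: norm_mult tail_def mult_right_mono)
  next
    case False
    then have "(\<Sum>chi\<in>X. c chi * chi (int (Suc n))) = 0"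
      unfolding expand using none by (intro sum.neutral ballI) (auto simp: not_less simp del: of_nat_Suc)
    then show ?thesis using False by (simp add: tail_def)
  qed
  have "norm (\<Sum>chi\<in>X. c chi * T chi) \<le> (\<Sum>n. real h * real K ^ 2 * tail n)"
    unfolding sums_unique[OF sums] by (rule norm_suminf_le[OF term_le]) (intro summable_mult summ_tail)
  also have "\<dots> = real h * real K ^ 2 * (\<Sum>n. tail n)" using summ_tail by (rule suminf_mult)
  finally have upper: "norm (\<Sum>chi\<in>X. c chi * T chi) \<le> real h * real K ^ 2 * (\<Sum>n. tail n)" .

  define W' where "W' = (\<Sum>n. if coprime (int (Suc n)) (int q) then w n else 0)"
  have cP: "c (principal_character q) = of_nat K ^ 2"
    unfolding c_def using a P1(3,4) P2(3,4) by (simp add: principal_character_def power2_eq_square)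
  have "(\<lambda>n. principal_character q (int (Suc n)) * complex_of_real (w n)) =
    (\<lambda>n. complex_of_real (if coprime (int (Suc n)) (int q) then w n else 0))"
    by (auto simp: principal_character_def simp del: of_nat_Suc)
  moreover have "summable (\<lambda>n. if coprime (int (Suc n)) (int q) then w n else 0)"
    by (rule summable_comparison_test'[OF w(2)]) (use w(1) in auto)
  ultimately have TP: "T (principal_character q) = of_real W'"
    unfolding T_def W'_def by (simp only: suminf_of_real)
  have "(\<Sum>chi\<in>X. c chi * T chi) = c (principal_character q) * T (principal_character q) +
      (\<Sum>chi\<in>X - {principal_character q}. c chi * T chi)"
    using fin prin by (rule sum.remove)
  then have "of_nat K ^ 2 * complex_of_real W' = (\<Sum>chi\<in>X. c chi * T chi) - (\<Sum>chi\<in>X - {principal_character q}. c chi * T chi)"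
    unfolding cP TP by simp
  then have "norm (of_nat K ^ 2 * complex_of_real W') \<le> norm (\<Sum>chi\<in>X. c chi * T chi) + norm (\<Sum>chi\<in>X - {principal_character q}. c chi * T chi)"
    by (simp only: norm_triangle_ineq4)
  also have "norm (\<Sum>chi\<in>X - {principal_character q}. c chi * T chi) \<le> B * real h * real K * (N / real q + 1)"
    unfolding c_def h_def X_def by (rule norm_sum_nonprincipal_le[OF q N a B P1 P2]) (use T in \<open>auto simp: T_def\<close>)
  also note upper
  finally have "real K ^ 2 * \<bar>W'\<bar> \<le> real h * real K ^ 2 * (\<Sum>n. tail n) + B * real h * real K * (N / real q + 1)"
    by (simp add: norm_mult norm_power)
  then have "real K * (real K * \<bar>W'\<bar>) \<le> real K * (real h * real K * (\<Sum>n. tail n) + B * real h * (N / real q + 1))"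
    by (simp add: power2_eq_square algebra_simps)
  then have "real K * \<bar>W'\<bar> \<le> real h * real K * (\<Sum>n. tail n) + B * real h * (N / real q + 1)"
    using K by (subst (asm) mult_le_cancel_left_pos) auto
  also have "\<dots> \<le> real q * real K * (\<Sum>n. tail n) + B * real q * (N / real q + 1)"
  proof (intro add_mono mult_right_mono mult_left_mono)
    show "0 \<le> (\<Sum>n. tail n)" by (rule suminf_nonneg[OF summ_tail]) (use w(1) in \<open>auto simp: tail_def\<close>)
  qed (use h B N in auto)
  also have "\<dots> = real q * real K * (\<Sum>n. tail n) + B * (N + real q)"
    using q by (simp add: field_simps)
  also have "\<dots> < real K * W" using large unfolding tail_def .
  also have "\<dots> \<le> real K * \<bar>W'\<bar>" using W unfolding W'_def by (intro mult_left_mono) auto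
  finally show False by simp
qed

section \<open>From a congruence back to two fractions\<close>

lemma exists_partial_fractions:
  fixes b :: int and p1 p2 :: nat
  assumes "coprime p1 p2" "p1 > 0" "p2 > 0"
  obtains a1 a2 :: int where
    "real_of_int b / (real p1 * real p2) = of_int a1 / of_nat p1 + of_int a2 / of_nat p2"
proof -
  have "coprime (int p1) (int p2)" using assms by simp
  then obtain u v where uv: "u * int p1 + v * int p2 = 1" using bezout_int by (metis coprime_iff_gcd_eq_1)
  have "real_of_int b = of_int (b * (u * int p1 + v * int p2))" using uv by simp
  also have "\<dots> = of_int (b * v) * real p2 + of_int (b * u) * real p1" by (simp add: algebra_simps)
  finally have "real_of_int b / (real p1 * real p2) = of_int (b * v) / of_nat p1 + of_int (b * u) / of_nat p2"
    using assms by (simp add: field_simps)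
  then show ?thesis by (rule that)
qed

text \<open>If n = a p1 p2 + q b, then a/q - (-b)/(p1 p2) equals n / (q p1 p2) exactly. So a small
  \<open>n\<close> makes the fraction good, and the factor 1/q in the error is automatic.\<close>

lemma approximation_of_residue:
  fixes \<alpha> E R :: real and a :: int and p1 p2 q n :: nat
  assumes p: "prime p1" "prime p2" "p1 \<noteq> p2" "real p1 \<le> N" "real p2 \<le> N"
    and q: "q > 0" and c: "[a * int p1 * int p2 = int n] (mod int q)"
    and R: "real n / (real p1 * real p2) \<le> R"
    and \<alpha>: "\<bar>\<alpha> - of_int a / real q\<bar> \<le> E / real q"
  shows "\<exists>(a1::int) (a2::int) (q1::nat) (q2::nat). prime q1 \<and> prime q2 \<and> q1 < q2 \<and> of_nat q2 \<le> N \<and>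
     \<bar>\<alpha> - of_int a1 / of_nat q1 - of_int a2 / of_nat q2\<bar> \<le> (E + R) / real q"
proof -
  have pos: "p1 > 0" "p2 > 0" using p by (auto intro: prime_gt_0_nat)
  obtain b where b: "int n = a * int p1 * int p2 + int q * b" using c unfolding cong_iff_lin by blast
  have "coprime p1 p2" using p by (simp add: primes_coprime)
  then obtain a1 a2 :: int where A: "real_of_int (- b) / (real p1 * real p2) = of_int a1 / of_nat p1 + of_int a2 / of_nat p2"
    using exists_partial_fractions pos by blast
  have "real n = of_int a * real p1 * real p2 + real q * of_int b"
    using arg_cong[OF b, of real_of_int] by simp
  then have "of_int a / real q - real_of_int (- b) / (real p1 * real p2) = real n / (real p1 * real p2) / real q"
    using pos q by (simp add: field_simps)
  then have "of_int a / real q - of_int a1 / of_nat p1 - of_int a2 / of_nat p2 = real n / (real p1 * real p2) / real q"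
    unfolding A by linarith
  then have "\<bar>of_int a / real q - of_int a1 / of_nat p1 - of_int a2 / of_nat p2\<bar> = real n / (real p1 * real p2) / real q"
    by (simp only: abs_of_nonneg divide_nonneg_nonneg mult_nonneg_nonneg of_nat_0_le_iff)
  also have "\<dots> \<le> R / real q" by (rule divide_right_mono[OF R]) simp
  finally have "\<bar>\<alpha> - of_int a1 / of_nat p1 - of_int a2 / of_nat p2\<bar> \<le> E / real q + R / real q"
    using \<alpha> by linarith
  then have le: "\<bar>\<alpha> - of_int a1 / of_nat p1 - of_int a2 / of_nat p2\<bar> \<le> (E + R) / real q"
    by (simp add: add_divide_distrib)
  show ?thesis
  proof (cases "p1 < p2")
    case True
    then show ?thesis using p le by blast
  next
    case False
    then have "p2 < p1" using p by simp
    moreover have "\<bar>\<alpha> - of_int a2 / of_nat p2 - of_int a1 / of_nat p1\<bar> \<le> (E + R) / real q"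
      using le by (simp add: algebra_simps)
    ultimately show ?thesis using p by blast
  qed
qed

section \<open>Tail and main term of the Gaussian weight\<close>

text \<open>Since u = ln (x / M) exceeds \<eta> ln N, the assumption \<open>large\<close> gives
  u^2/2 \<ge> 2u + 8 ln N. The part 2u yields (M / x)^2 and so summability; the rest yields N^(-8),
  chosen to outweigh q K M^2, which is at most N^(16/3) in the application.\<close>

lemma log_gauss_tail_le:
  assumes M: "M > 0" and N: "N > 1" and \<eta>: "\<eta> > 0" and large: "\<eta> * ln N / 2 \<ge> 2 + 8 / \<eta>"
    and x: "x > M * N powr \<eta>" "x \<ge> 1"
  shows "log_gauss M x \<le> M\<^sup>2 * N powr (-8) * (1 / x\<^sup>2)"
proof -
  define u where "u = ln (x / M)"
  have xpos: "x > 0" using x by simp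
  have "N powr \<eta> < x / M" using x M by (simp add: field_simps)
  then have "ln (N powr \<eta>) < u" unfolding u_def using N x M by (subst ln_less_cancel_iff) auto
  then have u: "u > \<eta> * ln N" using N by (simp add: ln_powr)
  have lnN: "ln N > 0" using N by simp
  have upos: "u > 0" using u \<eta> lnN by (meson less_trans mult_pos_pos)
  have "u * (2 + 8 / \<eta>) \<le> u * (u / 2)"
    using upos u large by (intro mult_left_mono) auto
  moreover have "8 * ln N \<le> u * (8 / \<eta>)"
    using u \<eta> by (simp add: field_simps)
  moreover have "u * (2 + 8 / \<eta>) = 2 * u + u * (8 / \<eta>)" "u * (u / 2) = u\<^sup>2 / 2"
    by (simp_all add: power2_eq_square algebra_simps)
  ultimately have "- u\<^sup>2 / 2 \<le> - (2 * u) - 8 * ln N" by linarith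
  then have "exp (- u\<^sup>2 / 2) \<le> exp (- (2 * u) - 8 * ln N)" by simp
  also have "\<dots> = exp (- u) ^ 2 * exp (- 8 * ln N)"
    by (simp add: exp_double[symmetric] exp_add[symmetric])
  also have "exp (- u) = M / x" unfolding u_def using M xpos by (simp add: exp_minus)
  also have "exp (- 8 * ln N) = N powr (-8)" using N by (simp add: powr_def)
  finally have *: "exp (- u\<^sup>2 / 2) \<le> (M / x)\<^sup>2 * N powr (-8)" .
  have "ln (M / x) = - u" unfolding u_def using M xpos by (simp add: ln_div)
  then have "log_gauss M x = exp (- u\<^sup>2 / 2) / sqrt x" unfolding log_gauss_def by simp
  also have "\<dots> \<le> exp (- u\<^sup>2 / 2) / 1" using x by (intro divide_left_mono) auto
  also note *
  finally show ?thesis by (simp add: power_divide mult_ac)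
qed

lemma log_gauss_tail_sum_le:
  assumes M: "M > 0" and N: "N > 1" and \<eta>: "\<eta> > 0" and large: "\<eta> * ln N / 2 \<ge> 2 + 8 / \<eta>"
  shows "(\<Sum>n. if real (Suc n) > M * N powr \<eta> then log_gauss M (real (Suc n)) else 0)
     \<le> M\<^sup>2 * N powr (-8) * (\<Sum>n. 1 / (real (Suc n))\<^sup>2)"
proof -
  have s: "summable (\<lambda>n. M\<^sup>2 * N powr (-8) * (1 / (real (Suc n))\<^sup>2))"
    by (intro summable_mult summable_inverse_Suc_squares)
  have le: "(if real (Suc n) > M * N powr \<eta> then log_gauss M (real (Suc n)) else 0)
      \<le> M\<^sup>2 * N powr (-8) * (1 / (real (Suc n))\<^sup>2)" for n
    using log_gauss_tail_le[OF assms, of "real (Suc n)"] by auto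
  have "summable (\<lambda>n. if real (Suc n) > M * N powr \<eta> then log_gauss M (real (Suc n)) else 0)"
    by (rule summable_comparison_test'[OF s])
      (use le log_gauss_nonneg[of "real (Suc n)" M for n] in \<open>auto simp del: of_nat_Suc\<close>)
  then have "(\<Sum>n. if real (Suc n) > M * N powr \<eta> then log_gauss M (real (Suc n)) else 0)
      \<le> (\<Sum>n. M\<^sup>2 * N powr (-8) * (1 / (real (Suc n))\<^sup>2))"
    using s le by (intro suminf_le) auto
  also have "\<dots> = M\<^sup>2 * N powr (-8) * (\<Sum>n. 1 / (real (Suc n))\<^sup>2)"
    by (rule suminf_mult[OF summable_inverse_Suc_squares])
  finally show ?thesis .
qed

text \<open>It suffices to keep the primes p in (M / (ln M)^2, M] that do not divide
  \<open>q\<close>. For them 0 \<le> ln (M / p) \<le> 2 ln ln M, so by \<open>small\<close> the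
  Gaussian is at least M^(-\<delta>), while 1 / sqrt p is at least M^(-1/2); by \<open>pr\<close>
  there are at least M^(1 - \<delta>) of them.\<close>

lemma log_gauss_prime_sum_ge:
  fixes q :: nat
  assumes M: "M > 0" and L: "ln M > 1" and pr: "M powr (1 - \<delta>) \<le>
    real (card {p::nat. prime p \<and> M / ln M ^ 2 < real p \<and> real p \<le> M \<and> \<not> p dvd q})"
    and small: "M powr (-\<delta>) \<le> exp (- (2 * ln (ln M))\<^sup>2 / 2)"
  shows "M powr (1/2 - 2 * \<delta>) \<le> (\<Sum>n. if coprime (int (Suc n)) (int q) then log_gauss M (real (Suc n)) else 0)"
proof -
  define S where "S = {p::nat. prime p \<and> M / ln M ^ 2 < real p \<and> real p \<le> M \<and> \<not> p dvd q}"
  define f where "f = (\<lambda>n. if coprime (int (Suc n)) (int q) then log_gauss M (real (Suc n)) else 0)"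
  have fin: "finite S" unfolding S_def
    by (rule finite_subset[of _ "{..nat \<lfloor>M\<rfloor>}"]) (auto simp: le_nat_floor)
  have summ: "summable f"
    by (rule summable_comparison_test'[OF summable_log_gauss[OF M]])
      (use log_gauss_nonneg[of "real (Suc n)" M for n] in \<open>auto simp: f_def simp del: of_nat_Suc\<close>)
  \<comment> \<open>Index 0 of \<open>f\<close> belongs to the integer 1, so the prime
    \<open>p\<close> sits at \<open>p - 1\<close>.\<close>
  have ge: "M powr (-\<delta> - 1/2) \<le> f (p - 1)" if "p \<in> S" for p
  proof -
    have p: "prime p" "M / ln M ^ 2 < real p" "real p \<le> M" "\<not> p dvd q" using that unfolding S_def by auto
    have "p > 0" using p(1) by (rule prime_gt_0_nat)
    then have Suc: "Suc (p - 1) = p" by simp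
    have cop: "coprime (int p) (int q)" using p by (simp add: prime_imp_coprime)
    have "1 \<le> M / real p" using p \<open>p > 0\<close> by simp
    have "ln M ^ 2 > 0" using L by simp
    then have "M < real p * ln M ^ 2" using p(2) by (simp only: divide_less_eq if_True)
    then have "M / real p \<le> ln M ^ 2" using \<open>p > 0\<close> by (simp add: divide_le_eq mult.commute)
    then have "0 \<le> ln (M / real p)" "ln (M / real p) \<le> ln (ln M ^ 2)"
      using \<open>1 \<le> M / real p\<close> \<open>ln M ^ 2 > 0\<close> by (auto intro!: ln_ge_zero ln_mono)
    moreover have "ln (ln M ^ 2) = 2 * ln (ln M)" using L by (simp add: ln_realpow)
    ultimately have "(ln (M / real p))\<^sup>2 \<le> (2 * ln (ln M))\<^sup>2" by (intro power_mono) auto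
    then have "exp (- (2 * ln (ln M))\<^sup>2 / 2) \<le> exp (- (ln (M / real p))\<^sup>2 / 2)" by simp
    then have "M powr (-\<delta>) \<le> exp (- (ln (M / real p))\<^sup>2 / 2)" using small by linarith
    then have "M powr (-\<delta>) / sqrt M \<le> exp (- (ln (M / real p))\<^sup>2 / 2) / sqrt (real p)"
      using p \<open>p > 0\<close> by (intro frac_le) auto
    also have "\<dots> = f (p - 1)" unfolding f_def Suc log_gauss_def using cop by simp
    also have "M powr (-\<delta>) / sqrt M = M powr (-\<delta> - 1/2)" using M by (simp add: powr_diff powr_half_sqrt)
    finally show ?thesis .
  qed
  have "M powr (1/2 - 2 * \<delta>) = M powr (1 - \<delta>) * M powr (-\<delta> - 1/2)" by (simp add: powr_add[symmetric])
  also have "\<dots> \<le> real (card S) * M powr (-\<delta> - 1/2)"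
    using pr unfolding S_def by (intro mult_right_mono) auto
  also have "\<dots> = (\<Sum>p\<in>S. M powr (-\<delta> - 1/2))" by simp
  also have "\<dots> \<le> (\<Sum>p\<in>S. f (p - 1))" by (intro sum_mono ge)
  also have "\<dots> = (\<Sum>n\<in>(\<lambda>p. p - 1) ` S. f n)"
  proof (rule sum.reindex_cong[symmetric, where l = "\<lambda>p. p - 1"])
    show "inj_on (\<lambda>p. p - 1) S"
    proof (rule inj_onI)
      fix x y assume "x \<in> S" "y \<in> S" "x - 1 = y - 1"
      moreover have "x > 0" "y > 0" using calculation unfolding S_def by (auto intro: prime_gt_0_nat)
      ultimately show "x = y" by simp
    qed
  qed auto
  also have "\<dots> \<le> (\<Sum>n. f n)"
    by (rule sum_le_suminf[OF summ]) (use fin in \<open>auto simp: f_def log_gauss_nonneg simp del: of_nat_Suc\<close>)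
  finally show ?thesis unfolding f_def .
qed

section \<open>Choice of the parameters and conclusion\<close>

lemma disjoint_subsets_of_card:
  assumes "2 * K \<le> card S"
  obtains A B where "A \<subseteq> S" "B \<subseteq> S" "A \<inter> B = {}" "card A = K" "card B = K" "finite A" "finite B"
proof -
  obtain A where A: "A \<subseteq> S" "card A = K" "finite A" using obtain_subset_with_card_n[of K S] assms by auto
  have "K \<le> card (S - A)" using assms A card_Diff_subset[of A S] by simp
  then obtain B where B: "B \<subseteq> S - A" "card B = K" "finite B" using obtain_subset_with_card_n[of K "S - A"] by auto
  then show ?thesis using that[of A B] A by auto
qed

text \<open>For fixed \<eta> all conditions compare functions of \<open>N\<close> alone, so one
  threshold serves every \<open>q\<close>, \<open>a\<close> and \<alpha>. Of the two terms in the
  final error, the first is the given distance from \<alpha> to a/q and the second bounds m / (p1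
  p2).\<close>

lemma eventually_approximation:
  fixes \<eta> C :: real
  assumes GLH: "\<And>q chi t. dirichlet_character q chi \<Longrightarrow>
      norm (dirichlet_L q chi (Complex (1/2) t)) \<le> C * (real q * (\<bar>t\<bar> + 1)) powr (\<eta> / 4)"
    and C: "C \<ge> 0" and \<eta>: "0 < \<eta>" "\<eta> \<le> 1/8"
  shows "eventually (\<lambda>N::real. \<forall>(q::nat) (a::int) \<alpha>.
      q > 0 \<longrightarrow> real q \<le> N powr (4/3) \<longrightarrow> coprime a (int q) \<longrightarrow>
      \<bar>\<alpha> - of_int a / real q\<bar> \<le> N powr (-4/3) / real q \<longrightarrow>
      (\<exists>(a1::int) (a2::int) (q1::nat) (q2::nat). prime q1 \<and> prime q2 \<and> q1 < q2 \<and> of_nat q2 \<le> N \<and>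
        \<bar>\<alpha> - of_int a1 / of_nat q1 - of_int a2 / of_nat q2\<bar> \<le> (N powr (-4/3) + N powr (8 * \<eta> - 4/3)) / real q)) at_top"
proof -
  define \<delta> where "\<delta> = \<eta> / 4"
  \<comment> \<open>The bound N^(1 - 2 \<delta>) for \<open>K\<close> times M^(1/2 - 2 \<delta>) has
    exponent 4/3 + 13 \<eta>/6 - 3 \<eta>^2, which exceeds 4/3 + \<eta> because \<eta> \<le> 1/8.
    The surplus 6 \<eta> over 2/3 pays for the losses in \<delta>.\<close>
  define c where "c = 2/3 + 6 * \<eta>"
  define J where "J = C * (LINT t|std_normal_distribution. \<bar>t\<bar> + 1)"
  define \<sigma> where "\<sigma> = (\<Sum>n. 1 / (real (Suc n))\<^sup>2)"
  have \<delta>: "\<delta> > 0" "\<delta> < 1" using \<eta> unfolding \<delta>_def by auto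
  have c: "c > 0" "2/3 \<le> c" "c \<le> 3/2" using \<eta> unfolding c_def by auto
  have J: "J \<ge> 0" unfolding J_def using C by (intro mult_nonneg_nonneg integral_nonneg) auto
  have \<sigma>: "\<sigma> \<ge> 0" unfolding \<sigma>_def by (intro suminf_nonneg summable_inverse_Suc_squares) auto
  have lim: "filterlim (\<lambda>N::real. N powr c) at_top at_top" using c by real_asymp
  have e1: "eventually (\<lambda>N::real. \<forall>q::nat. q > 0 \<and> real q \<le> N ^ 2 \<longrightarrow> N powr (1 - \<delta>) \<le>
      real (card {p::nat. prime p \<and> N / ln N ^ 2 < real p \<and> real p \<le> N \<and> \<not> p dvd q})) at_top"
    by (rule eventually_many_primes) fact
  have e2: "eventually (\<lambda>N::real. \<forall>q::nat. q > 0 \<and> real q \<le> (N powr c) ^ 2 \<longrightarrow> (N powr c) powr (1 - \<delta>) \<le>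
      real (card {p::nat. prime p \<and> N powr c / ln (N powr c) ^ 2 < real p \<and> real p \<le> N powr c \<and> \<not> p dvd q})) at_top"
    using eventually_compose_filterlim[OF eventually_many_primes[OF \<delta>(1)] lim] .
  have e3: "eventually (\<lambda>N::real. (N powr c) powr (-\<delta>) \<le> exp (- (2 * ln (ln (N powr c)))\<^sup>2 / 2)) at_top"
  proof -
    have "eventually (\<lambda>M::real. M powr (-\<delta>) \<le> exp (- (2 * ln (ln M))\<^sup>2 / 2)) at_top"
      using \<delta> by real_asymp
    then show ?thesis using eventually_compose_filterlim lim by blast
  qed
  have e4: "eventually (\<lambda>N::real. ln (N powr c) > 1) at_top" using c by real_asymp
  have e5: "eventually (\<lambda>N::real. \<eta> * ln N / 2 \<ge> 2 + 8 / \<eta>) at_top" using \<eta> by real_asymp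
  \<comment> \<open>Each of the two disjoint sets receives half of the available primes, rounded
    down.\<close>
  have e6: "eventually (\<lambda>N::real. N powr (1 - 2 * \<delta>) \<le> N powr (1 - \<delta>) / 2 - 1) at_top" using \<delta> by real_asymp
  \<comment> \<open>The tail contributes at most \<sigma>. The nonprincipal characters contribute at
    most the second term, as q^\<delta> \<le> N^(\<eta>/3) and N + q \<le> 2 N^(4/3).\<close>
  have e7: "eventually (\<lambda>N::real. \<sigma> + 2 * J * N powr (4/3 + \<eta>/3) < N powr (4/3 + \<eta>)) at_top" using \<eta> J \<sigma> by real_asymp
  \<comment> \<open>Both primes exceed N / (ln N)^2, so their product falls short of N^2 by at most
    a factor (ln N)^4.\<close>
  have e8: "eventually (\<lambda>N::real. ln N ^ 4 \<le> N powr \<eta>) at_top" using \<eta> by real_asymp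
  have e9: "eventually (\<lambda>N::real. ln N > 1) at_top" "eventually (\<lambda>N::real. N > 1) at_top" by real_asymp+
  from e1 e2 e3 e4 e5 e6 e7 e8 e9 show ?thesis
  proof eventually_elim
    case (elim N)
    note primesN = elim(1) and primesM = elim(2) and smallM = elim(3) and lnM = elim(4) and tailN = elim(5)
      and KN = elim(6) and main = elim(7) and ln4 = elim(8) and N = elim(9,10)
    define M where "M = N powr c"
    have Mpos: "M > 0" unfolding M_def using N by simp
    show ?case
    proof (intro allI impI)
      fix q :: nat and a :: int and \<alpha> :: real
      assume q: "q > 0" "real q \<le> N powr (4/3)" and a: "coprime a (int q)"
        and \<alpha>: "\<bar>\<alpha> - of_int a / real q\<bar> \<le> N powr (-4/3) / real q"
      define S where "S = {p::nat. prime p \<and> N / ln N ^ 2 < real p \<and> real p \<le> N \<and> \<not> p dvd q}"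
      define K where "K = nat \<lfloor>N powr (1 - \<delta>) / 2\<rfloor>"
      define w where "w = (\<lambda>n. log_gauss M (real (Suc n)))"
      define Y where "Y = M * N powr \<eta>"
      define B where "B = J * real q powr \<delta>"
      have qN2: "real q \<le> N ^ 2"
      proof -
        have "N powr (4/3) \<le> N powr 2" using N by (intro powr_mono) auto
        also have "N powr 2 = N ^ 2" using N by (simp add: powr_numeral)
        finally show ?thesis using q by linarith
      qed
      have qM2: "real q \<le> M ^ 2"
      proof -
        have "N powr (4/3) \<le> N powr (c * 2)" using N c by (intro powr_mono) auto
        also have "\<dots> = M ^ 2" unfolding M_def using N by (simp add: powr_powr[symmetric] powr_numeral)
        finally show ?thesis using q by linarith
      qed
      have K: "N powr (1 - 2 * \<delta>) \<le> real K" "real K \<le> N powr (1 - \<delta>) / 2"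
      proof -
        show "real K \<le> N powr (1 - \<delta>) / 2" unfolding K_def by (rule of_nat_floor) simp
        show "N powr (1 - 2 * \<delta>) \<le> real K" unfolding K_def using KN by linarith
      qed
      have K0: "K > 0"
      proof -
        have "0 < N powr (1 - 2 * \<delta>)" using N by simp
        then show ?thesis using K by linarith
      qed
      have "N powr (1 - \<delta>) \<le> real (card S)" unfolding S_def using primesN q(1) qN2 by blast
      then have "2 * K \<le> card S" using K by linarith
      then obtain P1 P2 where P: "P1 \<subseteq> S" "P2 \<subseteq> S" "P1 \<inter> P2 = {}" "card P1 = K" "card P2 = K" "finite P1" "finite P2"
        by (rule disjoint_subsets_of_card)
      have S: "prime p" "N / ln N ^ 2 < real p" "real p \<le> N" "coprime (int p) (int q)" if "p \<in> S" for p
        using that unfolding S_def by (auto simp: prime_imp_coprime)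
      have B0: "B \<ge> 0" unfolding B_def using J by simp
      have T: "norm (\<Sum>n. chi (int (Suc n)) * of_real (w n)) \<le> B"
        if "dirichlet_character q chi" "chi \<noteq> principal_character q" for chi
      proof -
        interpret nonprincipal_character q chi by unfold_locales (use that in auto)
        show ?thesis unfolding w_def B_def J_def
          by (rule norm_log_gauss_sum_le) (use GLH[OF that(1)] C \<delta> Mpos in \<open>auto simp: \<delta>_def\<close>)
      qed
      have W: "M powr (1/2 - 2 * \<delta>) \<le> (\<Sum>n. if coprime (int (Suc n)) (int q) then w n else 0)"
        unfolding w_def
        by (rule log_gauss_prime_sum_ge[OF Mpos]) (use lnM smallM primesM q(1) qM2 in \<open>auto simp: M_def\<close>)
      have large: "real q * real K * (\<Sum>n. if real (Suc n) > Y then w n else 0) + B * (N + real q)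
          < real K * M powr (1/2 - 2 * \<delta>)"
      proof -
        have "real q * real K * (\<Sum>n. if real (Suc n) > Y then w n else 0)
            \<le> N powr (4/3) * N powr 1 * (M\<^sup>2 * N powr (-8) * \<sigma>)"
        proof (intro mult_mono)
          have "N powr (1 - \<delta>) \<le> N powr 1" using N \<delta> by (intro powr_mono) auto
          then show "real K \<le> N powr 1" using K(2) powr_ge_zero[of N "1 - \<delta>"] by linarith
          show "(\<Sum>n. if real (Suc n) > Y then w n else 0) \<le> M\<^sup>2 * N powr (-8) * \<sigma>"
            unfolding Y_def w_def \<sigma>_def using N \<eta> tailN Mpos by (intro log_gauss_tail_sum_le) auto
          show "0 \<le> (\<Sum>n. if real (Suc n) > Y then w n else 0)"
          proof (rule suminf_nonneg)
            show "summable (\<lambda>n. if real (Suc n) > Y then w n else 0)" unfolding w_def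
              by (rule summable_comparison_test'[OF summable_log_gauss[OF Mpos]])
                (use log_gauss_nonneg[of "real (Suc n)" M for n] in \<open>auto simp del: of_nat_Suc\<close>)
          qed (auto simp: w_def log_gauss_nonneg simp del: of_nat_Suc)
        qed (use q in auto)
        also have "\<dots> = N powr (4/3 + 1 + 2 * c + (-8)) * \<sigma>"
        proof -
          have "M\<^sup>2 = N powr (2 * c)" unfolding M_def using N by (simp add: powr_powr[symmetric] powr_numeral mult.commute)
          then show ?thesis by (simp only: powr_add mult.assoc)
        qed
        also have "\<dots> \<le> N powr 0 * \<sigma>" using N c \<sigma> by (intro mult_right_mono powr_mono) auto
        also have "\<dots> = \<sigma>" using N by simp
        finally have 1: "real q * real K * (\<Sum>n. if real (Suc n) > Y then w n else 0) \<le> \<sigma>" .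
        have "B * (N + real q) \<le> (J * (N powr (4/3)) powr \<delta>) * (N powr (4/3) + N powr (4/3))"
        proof (intro mult_mono add_mono)
          show "B \<le> J * (N powr (4/3)) powr \<delta>" unfolding B_def
            using q \<delta> J by (intro mult_left_mono powr_mono2) auto
          have "N powr 1 \<le> N powr (4/3)" using N by (intro powr_mono) auto
          then show "N \<le> N powr (4/3)" using N by simp
        qed (use q N J in auto)
        also have "\<dots> = 2 * J * N powr (4/3 + \<eta>/3)"
          by (simp add: powr_powr powr_add[symmetric] \<delta>_def add.commute)
        finally have 2: "B * (N + real q) \<le> 2 * J * N powr (4/3 + \<eta>/3)" .
        have "N powr (4/3 + \<eta>) \<le> N powr ((1 - 2 * \<delta>) + c * (1/2 - 2 * \<delta>))"
        proof (rule powr_mono)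
          have "\<eta> * \<eta> \<le> \<eta> * (1/8)" using \<eta> by (intro mult_left_mono) auto
          then show "4/3 + \<eta> \<le> (1 - 2 * \<delta>) + c * (1/2 - 2 * \<delta>)"
            unfolding \<delta>_def c_def using \<eta> by (simp add: algebra_simps)
        qed (use N in auto)
        also have "\<dots> = N powr (1 - 2 * \<delta>) * M powr (1/2 - 2 * \<delta>)"
          unfolding M_def by (simp add: powr_add powr_powr)
        also have "\<dots> \<le> real K * M powr (1/2 - 2 * \<delta>)" using K by (intro mult_right_mono) auto
        finally show ?thesis using 1 2 main by linarith
      qed
      have "\<exists>p1\<in>P1. \<exists>p2\<in>P2. \<exists>n. real (Suc n) \<le> Y \<and> [a * int p1 * int p2 = int (Suc n)] (mod int q)"
      proof (rule exists_product_in_residue_class[where N = N, OF q(1) _ a B0 P(6) _ _ P(4) P(7) _ _ P(5) K0 _ _ T W large])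
        show "summable w" unfolding w_def by (rule summable_log_gauss[OF Mpos])
        show "w n \<ge> 0" for n unfolding w_def by (rule log_gauss_nonneg) simp
        show "N \<ge> 0" using N by simp
        show "real p \<le> N" "coprime (int p) (int q)" if "p \<in> P1" for p using P(1) S that by auto
        show "real p \<le> N" "coprime (int p) (int q)" if "p \<in> P2" for p using P(2) S that by auto
      qed
      then obtain p1 p2 n where p: "p1 \<in> P1" "p2 \<in> P2" "real (Suc n) \<le> Y" 
        "[a * int p1 * int p2 = int (Suc n)] (mod int q)" by blast
      then have pS: "p1 \<in> S" "p2 \<in> S" "p1 \<noteq> p2" using P by auto
      have bound: "real (Suc n) / (real p1 * real p2) \<le> N powr (8 * \<eta> - 4/3)"
      proof -
        have pos: "N / ln N ^ 2 > 0" using N by (intro divide_pos_pos) auto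
        have "real (Suc n) / (real p1 * real p2) \<le> Y / ((N / ln N ^ 2) * (N / ln N ^ 2))"
          using p(3) pos S(2)[OF pS(1)] S(2)[OF pS(2)] by (intro frac_le mult_mono mult_pos_pos) auto
        also have "\<dots> = Y * ln N ^ 4 / N ^ 2" by (simp add: power2_eq_square power4_eq_xxxx)
        also have "\<dots> \<le> Y * N powr \<eta> / N ^ 2"
          using ln4 Mpos by (intro divide_right_mono mult_left_mono) (auto simp: Y_def)
        also have "\<dots> = N powr (c + \<eta> + \<eta> - 2)"
          unfolding Y_def M_def powr_diff powr_add using N by (simp add: powr_numeral)
        also have "c + \<eta> + \<eta> - 2 = 8 * \<eta> - 4/3" unfolding c_def by simp
        finally show ?thesis .
      qed
      show "\<exists>(a1::int) (a2::int) (q1::nat) (q2::nat). prime q1 \<and> prime q2 \<and> q1 < q2 \<and> of_nat q2 \<le> N \<and>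
        \<bar>\<alpha> - of_int a1 / of_nat q1 - of_int a2 / of_nat q2\<bar> \<le> (N powr (-4/3) + N powr (8 * \<eta> - 4/3)) / real q"
        by (rule approximation_of_residue[OF S(1)[OF pS(1)] S(1)[OF pS(2)] pS(3) S(3)[OF pS(1)] S(3)[OF pS(2)] q(1) p(4) bound \<alpha>])
    qed
  qed
qed

text \<open>For bounded \<open>N\<close> an error of 1 is good enough: \<alpha> is that close to
  some a/2 + 0/3, and the right-hand side is at least 1 because q N^(4/3 - \<epsilon>) \<le>
  N^(8/3). The primes 2 and 3 are admissible since N \<ge> 3.\<close>

lemma bounded_approximation:
  fixes N \<alpha> \<epsilon> N0 :: real and q :: int
  assumes "3 \<le> N" "N \<le> N0" "1 \<le> q" "of_int q \<le> N powr (4/3)" "\<epsilon> > 0"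
  shows "\<exists>(a1::int) (a2::int) (q1::nat) (q2::nat). prime q1 \<and> prime q2 \<and> q1 < q2 \<and> of_nat q2 \<le> N \<and>
     \<bar>\<alpha> - of_int a1 / of_nat q1 - of_int a2 / of_nat q2\<bar> \<le> N0 powr (8/3) / (of_int q * N powr (4/3 - \<epsilon>))"
proof -
  define a where "a = \<lfloor>2 * \<alpha>\<rfloor>"
  have "\<bar>\<alpha> - of_int a / of_nat 2 - of_int 0 / of_nat 3\<bar> \<le> 1"
    unfolding a_def by (simp add: abs_if) linarith
  also have "1 \<le> N0 powr (8/3) / (of_int q * N powr (4/3 - \<epsilon>))"
  proof -
    have "of_int q * N powr (4/3 - \<epsilon>) \<le> N powr (4/3) * N powr (4/3)"
      using assms by (intro mult_mono powr_mono) auto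
    also have "\<dots> = N powr (8/3)" by (simp add: powr_add[symmetric])
    also have "\<dots> \<le> N0 powr (8/3)" using assms by (intro powr_mono2) auto
    finally show ?thesis using assms by (subst le_divide_eq) auto
  qed
  finally have "\<bar>\<alpha> - of_int a / of_nat 2 - of_int 0 / of_nat 3\<bar> \<le> N0 powr (8/3) / (of_int q * N powr (4/3 - \<epsilon>))" .
  moreover have "prime (2::nat)" "prime (3::nat)" by (rule two_is_prime_nat) simp
  ultimately show ?thesis using assms(1) by (intro exI[of _ a] exI[of _ 0] exI[of _ 2] exI[of _ 3]) auto
qed

theorem theorem7:
  fixes \<epsilon> :: real
  assumes "generalized_lindelof_hypothesis"
    and "\<epsilon> > 0"
  shows "\<exists>C::real. C > 0 \<and>
    (\<forall>(N::real) (\<alpha>::real) (a::int) (q::int).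
       N \<ge> 3 \<longrightarrow> 1 \<le> q \<longrightarrow> of_int q \<le> N powr (4/3) \<longrightarrow> coprime a q \<longrightarrow>
       \<bar>\<alpha> - of_int a / of_int q\<bar> \<le> 1 / (of_int q * N powr (4/3)) \<longrightarrow>
       (\<exists>(a\<^sub>1::int) (a\<^sub>2::int) (q\<^sub>1::nat) (q\<^sub>2::nat).
          prime q\<^sub>1 \<and> prime q\<^sub>2 \<and> q\<^sub>1 < q\<^sub>2 \<and> of_nat q\<^sub>2 \<le> N \<and>
          \<bar>\<alpha> - of_int a\<^sub>1 / of_nat q\<^sub>1 - of_int a\<^sub>2 / of_nat q\<^sub>2\<bar>
            \<le> C / (of_int q * N powr (4/3 - \<epsilon>))))"
proof -
  \<comment> \<open>The loss N^(8 \<eta>) in \<open>eventually_approximation\<close> must not exceed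
    N^\<epsilon>; the minimum with 1 secures \<eta> \<le> 1/8.\<close>
  define \<eta> where "\<eta> = min \<epsilon> 1 / 8"
  have \<eta>: "0 < \<eta>" "\<eta> \<le> 1/8" "8 * \<eta> \<le> \<epsilon>" unfolding \<eta>_def using assms(2) by auto
  obtain C0 where C0: "\<And>q chi t. dirichlet_character q chi \<Longrightarrow>
      norm (dirichlet_L q chi (Complex (1/2) t)) \<le> C0 * (real q * (\<bar>t\<bar> + 1)) powr (\<eta> / 4)"
    using assms(1) \<eta>(1) unfolding generalized_lindelof_hypothesis_def
    by (metis divide_pos_pos zero_less_numeral)
  define C1 where "C1 = max C0 0"
  have C1: "norm (dirichlet_L q chi (Complex (1/2) t)) \<le> C1 * (real q * (\<bar>t\<bar> + 1)) powr (\<eta> / 4)"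
    if "dirichlet_character q chi" for q chi t
    using C0[OF that, of t] mult_right_mono[of C0 C1 "(real q * (\<bar>t\<bar> + 1)) powr (\<eta> / 4)"]
    unfolding C1_def by simp
  have "C1 \<ge> 0" unfolding C1_def by simp
  from eventually_approximation[OF C1 this \<eta>(1,2)] obtain N0 where N0: "\<forall>N\<ge>N0. \<forall>(q::nat) (a::int) \<alpha>.
      q > 0 \<longrightarrow> real q \<le> N powr (4/3) \<longrightarrow> coprime a (int q) \<longrightarrow>
      \<bar>\<alpha> - of_int a / real q\<bar> \<le> N powr (-4/3) / real q \<longrightarrow>
      (\<exists>(a1::int) (a2::int) (q1::nat) (q2::nat). prime q1 \<and> prime q2 \<and> q1 < q2 \<and> of_nat q2 \<le> N \<and>
        \<bar>\<alpha> - of_int a1 / of_nat q1 - of_int a2 / of_nat q2\<bar> \<le> (N powr (-4/3) + N powr (8 * \<eta> - 4/3)) / real q)"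
    unfolding eventually_at_top_linorder by blast
  \<comment> \<open>The 2 covers the two error terms for large \<open>N\<close>, each at most
    N^(\<epsilon> - 4/3) / q; the other entry covers \<open>N\<close> below
    \<open>N0\<close>.\<close>
  define C where "C = max 2 (N0 powr (8/3))"
  have weaken: "x \<le> C / (of_int q * N powr (4/3 - \<epsilon>))" if "x \<le> y / (of_int q * N powr (4/3 - \<epsilon>))" "y \<le> C" "1 \<le> q" for x y N and q :: int
  proof -
    have "y / (of_int q * N powr (4/3 - \<epsilon>)) \<le> C / (of_int q * N powr (4/3 - \<epsilon>))"
      using that by (intro divide_right_mono) auto
    then show ?thesis using that by linarith
  qed
  show ?thesis
  proof (intro exI[of _ C] conjI allI impI)
    show "C > 0" unfolding C_def by simp
    fix N \<alpha> :: real and a q :: int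
    assume N: "N \<ge> 3" and q: "1 \<le> q" "of_int q \<le> N powr (4/3)" "coprime a q"
      and \<alpha>: "\<bar>\<alpha> - of_int a / of_int q\<bar> \<le> 1 / (of_int q * N powr (4/3))"
    show "\<exists>(a\<^sub>1::int) (a\<^sub>2::int) (q\<^sub>1::nat) (q\<^sub>2::nat).
          prime q\<^sub>1 \<and> prime q\<^sub>2 \<and> q\<^sub>1 < q\<^sub>2 \<and> of_nat q\<^sub>2 \<le> N \<and>
          \<bar>\<alpha> - of_int a\<^sub>1 / of_nat q\<^sub>1 - of_int a\<^sub>2 / of_nat q\<^sub>2\<bar>
            \<le> C / (of_int q * N powr (4/3 - \<epsilon>))"
    proof (cases "N \<ge> N0")
      case True
      define q' where "q' = nat q"
      have q': "int q' = q" "real q' = of_int q" "q' > 0" unfolding q'_def using q by auto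
      have "1 / (of_int q * N powr (4/3)) = N powr (-4/3) / real q'"
        unfolding q'(2) using N by (simp add: powr_minus_divide)
      then have "\<bar>\<alpha> - of_int a / real q'\<bar> \<le> N powr (-4/3) / real q'" using \<alpha> q' by simp
      then obtain a1 a2 :: int and q1 q2 :: nat where *: "prime q1" "prime q2" "q1 < q2" "of_nat q2 \<le> N"
        "\<bar>\<alpha> - of_int a1 / of_nat q1 - of_int a2 / of_nat q2\<bar> \<le> (N powr (-4/3) + N powr (8 * \<eta> - 4/3)) / real q'"
        using N0[rule_format, OF True, of q' a \<alpha>] q q' by auto
      have "N powr (-4/3) \<le> N powr (\<epsilon> - 4/3)" "N powr (8 * \<eta> - 4/3) \<le> N powr (\<epsilon> - 4/3)"
        using N \<eta> assms(2) by (auto intro!: powr_mono)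
      then have "(N powr (-4/3) + N powr (8 * \<eta> - 4/3)) / real q' \<le> 2 * N powr (\<epsilon> - 4/3) / real q'"
        by (intro divide_right_mono) auto
      also have "\<dots> = 2 / (of_int q * N powr (4/3 - \<epsilon>))"
        unfolding q'(2) using powr_minus_divide[of N "4/3 - \<epsilon>"] by simp
      finally have "\<bar>\<alpha> - of_int a1 / of_nat q1 - of_int a2 / of_nat q2\<bar> \<le> 2 / (of_int q * N powr (4/3 - \<epsilon>))"
        using *(5) by linarith
      then have "\<bar>\<alpha> - of_int a1 / of_nat q1 - of_int a2 / of_nat q2\<bar> \<le> C / (of_int q * N powr (4/3 - \<epsilon>))"
        by (rule weaken) (use q in \<open>auto simp: C_def\<close>)
      then show ?thesis using *(1-4) by blast
    next
      case False
      then obtain a1 a2 :: int and q1 q2 :: nat where *: "prime q1" "prime q2" "q1 < q2" "of_nat q2 \<le> N"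
        "\<bar>\<alpha> - of_int a1 / of_nat q1 - of_int a2 / of_nat q2\<bar> \<le> N0 powr (8/3) / (of_int q * N powr (4/3 - \<epsilon>))"
        using bounded_approximation[of N N0 q \<epsilon> \<alpha>] N q assms(2) by auto
      have "\<bar>\<alpha> - of_int a1 / of_nat q1 - of_int a2 / of_nat q2\<bar> \<le> C / (of_int q * N powr (4/3 - \<epsilon>))"
        by (rule weaken[OF *(5)]) (use q in \<open>auto simp: C_def\<close>)
      then show ?thesis using *(1-4) by blast
    qed
  qed
qed

end
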